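(* (In $\mathbf{ZF+CMC}$.) For every completely regular space $\mathbf{X}$, $(\mathbf{X})_z=(\mathbf{X})_{\delta}$ and $(\mathbf{X})_z$ is a $P$-space.
   Context: The base theory is $\mathbf{ZF}$ (the Axiom of Choice is not assumed) together with $\mathbf{CMC}$: for every family $\{A_n:n\in\omega\}$ of non-empty sets there is a function assigning to each $n\in\omega$ a non-empty finite subset of $A_n$. A zero-set of $\mathbf{X}$ is a set $f^{-1}[\{0\}]$ with $f:\mathbf{X}\to\mathbb{R}$ continuous; $\mathbf{X}$ is completely regular (not necessarily $T_1$) if the complements of zero-sets form a base of $\mathbf{X}$. For a topological space $\mathbf{X}=\langle X,\tau\rangle$: $(\mathbf{X})_z=\langle X,\tau_z\rangle$, where the Baire topology $\tau_z$ is the topology on $X$ having the family of all zero-sets of $\mathbf{X}$ as a base; $(\mathbf{X})_\delta=\langle X,\tau_\delta\rangle$, where the $G_\delta$-topology $\tau_\delta$ is the topology on $X$ having the family of all $G_\delta$-sets of $\mathbf{X}$ as a base. A space is a $P$-space if the family of all its $G_\delta$-sets is equal to its topology, i.e. every $G_\delta$-set is open. *)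

theory Defs
  imports "HOL-Algebra.Ring"
begin

text \<open>
  Isabelle/HOL has the axiom of choice built in, so a theorem of ZF + CMC cannot be rendered by
  a statement about HOL types and sets without assuming more than ZF + CMC. Instead, a binary
  relation \<open>mem\<close> on a type \<open>'m\<close> is required to be a model of first-order ZF in which
  CMC holds, and all the notions below are interpreted in that model: spaces, functions,
  families, natural numbers and real numbers are elements of \<open>'m\<close>, and every quantifier
  ranges over elements of \<open>'m\<close>. A sentence holds in all such models iff it is a theorem of
  ZF + CMC (completeness theorem; countable models suffice).

  In particular no definition may quantify over HOL subsets of \<open>'m\<close> or HOL functions on
  \<open>'m\<close>. The HOL set \<open>elts a\<close> of the model's members of \<open>a\<close> only serves to write
  first-order conditions in familiar notation.
\<close>

section \<open>Models of ZF\<close>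

datatype form =
    Mem nat nat | Equal nat nat | Neg form | Conj form form | Forall nat form

primrec sat :: "('m \<Rightarrow> 'm \<Rightarrow> bool) \<Rightarrow> (nat \<Rightarrow> 'm) \<Rightarrow> form \<Rightarrow> bool" where
  "sat mem s (Mem i j) \<longleftrightarrow> mem (s i) (s j)"
| "sat mem s (Equal i j) \<longleftrightarrow> s i = s j"
| "sat mem s (Neg \<phi>) \<longleftrightarrow> \<not> sat mem s \<phi>"
| "sat mem s (Conj \<phi> \<psi>) \<longleftrightarrow> sat mem s \<phi> \<and> sat mem s \<psi>"
| "sat mem s (Forall i \<phi>) \<longleftrightarrow> (\<forall>a. sat mem (s(i := a)) \<phi>)"

record 'm ordered_field_structure =
  Dom :: 'm
  Add :: 'm
  Mul :: 'm
  Zer :: 'm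
  One :: 'm
  Less :: 'm

context
  fixes mem :: "'m \<Rightarrow> 'm \<Rightarrow> bool"  (infix "\<epsilon>" 50)
begin

definition elts :: "'m \<Rightarrow> 'm set" where
  "elts a = {x. x \<epsilon> a}"

definition extensionality_axiom :: bool where
  "extensionality_axiom \<longleftrightarrow> (\<forall>a b. elts a = elts b \<longrightarrow> a = b)"

definition foundation_axiom :: bool where
  "foundation_axiom \<longleftrightarrow> (\<forall>a. elts a \<noteq> {} \<longrightarrow> (\<exists>x\<in>elts a. elts x \<inter> elts a = {}))"

definition pairing_axiom :: bool where
  "pairing_axiom \<longleftrightarrow> (\<forall>a b. \<exists>c. elts c = {a, b})"

definition union_axiom :: bool where
  "union_axiom \<longleftrightarrow> (\<forall>a. \<exists>u. elts u = (\<Union>x\<in>elts a. elts x))"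

definition power_set_axiom :: bool where
  "power_set_axiom \<longleftrightarrow> (\<forall>a. \<exists>p. elts p = {b. elts b \<subseteq> elts a})"

definition is_inductive :: "'m \<Rightarrow> bool" where
  "is_inductive w \<longleftrightarrow>
     (\<exists>e\<in>elts w. elts e = {}) \<and>
     (\<forall>n\<in>elts w. \<exists>s\<in>elts w. elts s = insert n (elts n))"

definition infinity_axiom :: bool where
  "infinity_axiom \<longleftrightarrow> (\<exists>w. is_inductive w)"

text \<open>In both schemas the assignment \<open>s\<close> supplies the parameters of \<open>\<phi>\<close>.\<close>

definition separation_schema :: bool where
  "separation_schema \<longleftrightarrow>
     (\<forall>\<phi> s a. \<exists>b. elts b = {x \<in> elts a. sat mem (s(0 := x)) \<phi>})"

definition replacement_schema :: bool where
  "replacement_schema \<longleftrightarrow>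
     (\<forall>\<phi> s a. (\<forall>x\<in>elts a. \<exists>!y. sat mem (s(0 := x, 1 := y)) \<phi>) \<longrightarrow>
        (\<exists>b. elts b = {y. \<exists>x\<in>elts a. sat mem (s(0 := x, 1 := y)) \<phi>}))"

definition ZF_model :: bool where
  "ZF_model \<longleftrightarrow>
     extensionality_axiom \<and> foundation_axiom \<and> pairing_axiom \<and> union_axiom \<and> power_set_axiom \<and>
     infinity_axiom \<and> separation_schema \<and> replacement_schema"

section \<open>Functions, finite sets and CMC inside the model\<close>

text \<open>Kuratowski pairs.\<close>

definition is_pair :: "'m \<Rightarrow> 'm \<Rightarrow> 'm \<Rightarrow> bool" where
  "is_pair p a b \<longleftrightarrow> elts p = {z. elts z = {a} \<or> elts z = {a, b}}"

definition is_product :: "'m \<Rightarrow> 'm \<Rightarrow> 'm \<Rightarrow> bool" where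
  "is_product p a b \<longleftrightarrow> elts p = {z. \<exists>x\<in>elts a. \<exists>y\<in>elts b. is_pair z x y}"

definition related :: "'m \<Rightarrow> 'm \<Rightarrow> 'm \<Rightarrow> bool" where
  "related r x y \<longleftrightarrow> (\<exists>p\<in>elts r. is_pair p x y)"

definition is_function :: "'m \<Rightarrow> 'm \<Rightarrow> 'm \<Rightarrow> bool" where
  "is_function f a b \<longleftrightarrow>
     (\<forall>p\<in>elts f. \<exists>x\<in>elts a. \<exists>y\<in>elts b. is_pair p x y) \<and>
     (\<forall>x\<in>elts a. \<exists>!y. related f x y)"

definition app :: "'m \<Rightarrow> 'm \<Rightarrow> 'm" where
  "app f x = (THE y. related f x y)"

definition app2 :: "'m \<Rightarrow> 'm \<Rightarrow> 'm \<Rightarrow> 'm" where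
  "app2 f x y = app f (THE p. is_pair p x y)"

definition is_omega :: "'m \<Rightarrow> bool" where
  "is_omega w \<longleftrightarrow> is_inductive w \<and> (\<forall>v. is_inductive v \<longrightarrow> elts w \<subseteq> elts v)"

text \<open>Equipotent, by a bijection in the model, to a von Neumann natural number of the model.\<close>

definition finite_in_model :: "'m \<Rightarrow> bool" where
  "finite_in_model a \<longleftrightarrow>
     (\<exists>w n f. is_omega w \<and> n \<in> elts w \<and> is_function f n a \<and>
        (\<forall>y\<in>elts a. \<exists>!x. x \<in> elts n \<and> app f x = y))"

definition CMC :: bool where
  "CMC \<longleftrightarrow>
     (\<forall>w b A. is_omega w \<and> is_function A w b \<and> (\<forall>n\<in>elts w. elts (app A n) \<noteq> {}) \<longrightarrow>
        (\<exists>c F. is_function F w c \<and>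
           (\<forall>n\<in>elts w. elts (app F n) \<noteq> {} \<and> elts (app F n) \<subseteq> elts (app A n) \<and>
              finite_in_model (app F n))))"

section \<open>The real line inside the model\<close>

definition field_ring :: "'m ordered_field_structure \<Rightarrow> 'm ring" where
  "field_ring R =
     \<lparr>carrier = elts (Dom R), mult = app2 (Mul R), one = One R, zero = Zer R, add = app2 (Add R)\<rparr>"

definition less_real :: "'m ordered_field_structure \<Rightarrow> 'm \<Rightarrow> 'm \<Rightarrow> bool" where
  "less_real R x y \<longleftrightarrow> related (Less R) x y"

text \<open>
  A real line is a complete ordered field of the model; ZF proves that there is exactly one up to
  isomorphism. Completeness refers only to the subsets of the field that belong to the model.
  The library predicate \<open>field\<close> is a first-order condition on its argument.
\<close>

definition real_line :: "'m ordered_field_structure \<Rightarrow> bool" where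
  "real_line R \<longleftrightarrow>
     (\<exists>P. is_product P (Dom R) (Dom R) \<and>
        is_function (Add R) P (Dom R) \<and> is_function (Mul R) P (Dom R)) \<and>
     field (field_ring R) \<and>
     (\<forall>x\<in>elts (Dom R). \<not> less_real R x x) \<and>
     (\<forall>x\<in>elts (Dom R). \<forall>y\<in>elts (Dom R). \<forall>z\<in>elts (Dom R).
        less_real R x y \<longrightarrow> less_real R y z \<longrightarrow> less_real R x z) \<and>
     (\<forall>x\<in>elts (Dom R). \<forall>y\<in>elts (Dom R). less_real R x y \<or> x = y \<or> less_real R y x) \<and>
     (\<forall>x\<in>elts (Dom R). \<forall>y\<in>elts (Dom R). \<forall>z\<in>elts (Dom R).
        less_real R x y \<longrightarrow> less_real R (app2 (Add R) x z) (app2 (Add R) y z)) \<and>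
     (\<forall>x\<in>elts (Dom R). \<forall>y\<in>elts (Dom R).
        less_real R (Zer R) x \<longrightarrow> less_real R (Zer R) y \<longrightarrow> less_real R (Zer R) (app2 (Mul R) x y)) \<and>
     (\<forall>A. elts A \<subseteq> elts (Dom R) \<and> elts A \<noteq> {} \<and>
        (\<exists>u\<in>elts (Dom R). \<forall>x\<in>elts A. \<not> less_real R u x) \<longrightarrow>
        (\<exists>u\<in>elts (Dom R). (\<forall>x\<in>elts A. \<not> less_real R u x) \<and>
           (\<forall>v\<in>elts (Dom R). (\<forall>x\<in>elts A. \<not> less_real R v x) \<longrightarrow> \<not> less_real R v u)))"

definition real_open :: "'m ordered_field_structure \<Rightarrow> 'm \<Rightarrow> bool" where
  "real_open R V \<longleftrightarrow>
     elts V \<subseteq> elts (Dom R) \<and>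
     (\<forall>x\<in>elts V. \<exists>a\<in>elts (Dom R). \<exists>b\<in>elts (Dom R). less_real R a x \<and> less_real R x b \<and>
        {y \<in> elts (Dom R). less_real R a y \<and> less_real R y b} \<subseteq> elts V)"

section \<open>Topological spaces inside the model\<close>

definition topological_space_on :: "'m \<Rightarrow> 'm \<Rightarrow> bool" where
  "topological_space_on X \<tau> \<longleftrightarrow>
     (\<forall>U\<in>elts \<tau>. elts U \<subseteq> elts X) \<and> X \<in> elts \<tau> \<and>
     (\<forall>U\<in>elts \<tau>. \<forall>V\<in>elts \<tau>. \<exists>W\<in>elts \<tau>. elts W = elts U \<inter> elts V) \<and>
     (\<forall>S. elts S \<subseteq> elts \<tau> \<longrightarrow> (\<exists>W\<in>elts \<tau>. elts W = (\<Union>U\<in>elts S. elts U)))"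

text \<open>
  The family \<open>B\<close> is a HOL set here, but it is only instantiated with first-order definable
  families of subsets of \<open>X\<close>, which are sets of the model.
\<close>

definition is_base :: "'m \<Rightarrow> 'm set \<Rightarrow> bool" where
  "is_base \<tau> B \<longleftrightarrow>
     B \<subseteq> elts \<tau> \<and> (\<forall>U\<in>elts \<tau>. \<exists>S. elts S \<subseteq> B \<and> elts U = (\<Union>V\<in>elts S. elts V))"

definition continuous_real ::
    "'m ordered_field_structure \<Rightarrow> 'm \<Rightarrow> 'm \<Rightarrow> 'm \<Rightarrow> bool" where
  "continuous_real R X \<tau> f \<longleftrightarrow>
     is_function f X (Dom R) \<and>
     (\<forall>V. real_open R V \<longrightarrow> (\<exists>U\<in>elts \<tau>. elts U = {x \<in> elts X. app f x \<in> elts V}))"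

definition zero_set :: "'m ordered_field_structure \<Rightarrow> 'm \<Rightarrow> 'm \<Rightarrow> 'm \<Rightarrow> bool" where
  "zero_set R X \<tau> Z \<longleftrightarrow>
     (\<exists>f. continuous_real R X \<tau> f \<and> elts Z = {x \<in> elts X. app f x = Zer R})"

definition completely_regular :: "'m ordered_field_structure \<Rightarrow> 'm \<Rightarrow> 'm \<Rightarrow> bool" where
  "completely_regular R X \<tau> \<longleftrightarrow>
     topological_space_on X \<tau> \<and>
     is_base \<tau> {U. \<exists>Z. zero_set R X \<tau> Z \<and> elts U = elts X - elts Z}"

definition G_delta_set :: "'m \<Rightarrow> 'm \<Rightarrow> bool" where
  "G_delta_set \<tau> G \<longleftrightarrow>
     (\<exists>w F. is_omega w \<and> is_function F w \<tau> \<and> elts G = (\<Inter>n\<in>elts w. elts (app F n)))"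

text \<open>The last argument is the Baire topology, respectively the \<open>G\<^sub>\<delta>\<close>-topology.\<close>

definition is_Baire_topology ::
    "'m ordered_field_structure \<Rightarrow> 'm \<Rightarrow> 'm \<Rightarrow> 'm \<Rightarrow> bool" where
  "is_Baire_topology R X \<tau> \<tau>z \<longleftrightarrow>
     topological_space_on X \<tau>z \<and> is_base \<tau>z {Z. zero_set R X \<tau> Z}"

definition is_G_delta_topology :: "'m \<Rightarrow> 'm \<Rightarrow> 'm \<Rightarrow> bool" where
  "is_G_delta_topology X \<tau> \<tau>d \<longleftrightarrow>
     topological_space_on X \<tau>d \<and> is_base \<tau>d {G. G_delta_set \<tau> G}"

definition P_space :: "'m \<Rightarrow> 'm \<Rightarrow> bool" where
  "P_space X \<tau> \<longleftrightarrow> topological_space_on X \<tau> \<and> {G. G_delta_set \<tau> G} = elts \<tau>"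

end

end

theory Submission
  imports Defs
begin

text \<open>
  Let \<open>\<tau>z\<close> consist of the subsets of \<open>X\<close> that contain, with each of their points \<open>x\<close>, a
  zero-set around \<open>x\<close>. Everything follows from one fact: if each of countably many sets contains
  a zero-set around \<open>x\<close>, then so does their intersection (\<open>zero_set_countable_Inter\<close>). It shows
  that a countable intersection of sets from \<open>\<tau>z\<close> is again in \<open>\<tau>z\<close>, which is the \<open>P\<close>-space
  property. In a completely regular space every open set is in \<open>\<tau>z\<close>: if \<open>g x = c \<noteq> 0\<close> and \<open>g\<close>
  vanishes off \<open>U\<close>, then \<open>{g = c}\<close> is a zero-set between \<open>x\<close> and \<open>U\<close>
  (\<open>zero_set_in_open\<close>). Hence \<open>G\<^sub>\<delta>\<close>-sets are in \<open>\<tau>z\<close>. Conversely a zero-set is a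
  \<open>G\<^sub>\<delta>\<close>-set (\<open>zero_set_G_delta\<close>), so zero-sets and \<open>G\<^sub>\<delta>\<close>-sets are bases of the same
  topology.

  For the countable intersection, let \<open>A n\<close> be the set of continuous \<open>g \<ge> 0\<close> with \<open>g x = 0\<close> whose
  zeros lie in the \<open>n\<close>-th set. Without choice one cannot pick \<open>g \<in> A n\<close> for all \<open>n\<close>, but CMC
  gives finite non-empty \<open>G n \<subseteq> A n\<close>, and then
  \<open>h y = sup {min (g y) (e n) | n \<in> \<omega>, g \<in> G n}\<close>, with \<open>e n = 1 / (n + 1)\<close>, requires no further
  selection. Its zeros are the common zeros of all members of all \<open>G n\<close>. It is continuous because
  for \<open>b > 0\<close> only the finitely many \<open>n\<close> with \<open>e n \<ge> b\<close>, and for each of them only the finitely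
  many \<open>g \<in> G n\<close>, restrict the points where \<open>h \<le> b\<close>; thus that condition is controlled by a
  finite intersection of open sets (\<open>capped_supremum_continuous\<close>).

  All this takes place inside a model of ZF. A set of the model is obtained from a property only
  through a first-order formula, so each construction comes with a proof that the property is
  definable with parameters; that predicate is closed under the connectives, the quantifiers and
  substitution of definable functions, and the rules \<open>definable_intros\<close> then discharge these
  obligations by following the syntax of the property. The same remark applies to induction: only
  definable properties may be proved by induction on the natural numbers of the model, which may
  be nonstandard when seen from outside. Choosing witnesses with the meta-logic is harmless as
  long as the graph of the resulting function is definable on its domain
  (\<open>function_exists\<close>).
\<close>


section \<open>Satisfaction and renaming of variables\<close>

primrec rename :: "(nat \<Rightarrow> nat) \<Rightarrow> form \<Rightarrow> form" where
  "rename f (Mem i j) = Mem (f i) (f j)"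
| "rename f (Equal i j) = Equal (f i) (f j)"
| "rename f (Neg \<phi>) = Neg (rename f \<phi>)"
| "rename f (Conj \<phi> \<psi>) = Conj (rename f \<phi>) (rename f \<psi>)"
| "rename f (Forall i \<phi>) = Forall (f i) (rename f \<phi>)"

text \<open>
  Injectivity ensures that no variable is captured: an update of the renamed bound variable
  affects no other variable.
\<close>

lemma sat_rename:
  assumes "inj f"
  shows "sat mem s (rename f \<phi>) \<longleftrightarrow> sat mem (\<lambda>n. s (f n)) \<phi>"
proof (induction \<phi> arbitrary: s)
  case (Forall i \<phi>)
  have "(\<lambda>n. (s(f i := a)) (f n)) = (\<lambda>n. s (f n))(i := a)" for a
    using assms by (auto simp: fun_eq_iff inj_eq)
  then show ?case by (simp add: Forall)
qed simp_all

text \<open>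
  Even variables of a formula are read as proper variables and odd ones as parameters. Both kinds
  are then unlimited in supply, so the parameters of two formulas can be merged and a fresh bound
  variable can be found by renaming.
\<close>

definition interleave :: "(nat \<Rightarrow> 'a) \<Rightarrow> (nat \<Rightarrow> 'a) \<Rightarrow> nat \<Rightarrow> 'a" where
  "interleave s c n = (if even n then s (n div 2) else c (n div 2))"

lemma interleave_simps [simp]:
  "interleave s c 0 = s 0"
  "interleave s c (2 * n) = s n"
  "interleave s c (Suc (2 * n)) = c n"
  by (auto simp: interleave_def)

lemma interleave_eqI:
  assumes "\<And>n. s n = t (2 * n)" "\<And>n. c n = t (Suc (2 * n))"
  shows "interleave s c = t"
proof
  fix n show "interleave s c n = t n"
    by (cases "even n") (auto elim!: evenE oddE simp: assms)
qed

locale ZF =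
  fixes mem :: "'m \<Rightarrow> 'm \<Rightarrow> bool"
  assumes ZF: "ZF_model mem"
begin

abbreviation El :: "'m \<Rightarrow> 'm set" where "El \<equiv> elts mem"

section \<open>Definability with parameters\<close>

definition definable :: "((nat \<Rightarrow> 'm) \<Rightarrow> bool) \<Rightarrow> bool" where
  "definable P \<longleftrightarrow> (\<exists>\<phi> c. \<forall>s. P s \<longleftrightarrow> sat mem (interleave s c) \<phi>)"

text \<open>
  A term counts as definable if its graph is: variable \<open>0\<close> holds the value and the remaining
  variables, shifted down by one, are the arguments.
\<close>

definition definable_term :: "((nat \<Rightarrow> 'm) \<Rightarrow> 'm) \<Rightarrow> bool" where
  "definable_term t \<longleftrightarrow> definable (\<lambda>s. s 0 = t (\<lambda>n. s (Suc n)))"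

named_theorems definable_intros

lemma definable_cong: "definable P \<Longrightarrow> (\<And>s. P s = Q s) \<Longrightarrow> definable Q"
  by (subgoal_tac "P = Q") auto

lemma definable_not [definable_intros]:
  assumes "definable P" shows "definable (\<lambda>s. \<not> P s)"
  using assms unfolding definable_def by (metis sat.simps(3))

text \<open>
  The formulas for \<open>P\<close> and \<open>Q\<close> use different parameters. The two parameter sequences are
  interleaved again, and the odd variables of each formula are renamed to match.
\<close>

lemma definable_conj [definable_intros]:
  assumes "definable P" "definable Q"
  shows "definable (\<lambda>s. P s \<and> Q s)"
proof -
  obtain \<phi> c where 1: "\<And>s. P s \<longleftrightarrow> sat mem (interleave s c) \<phi>"
    using assms(1) unfolding definable_def by auto
  obtain \<psi> d where 2: "\<And>s. Q s \<longleftrightarrow> sat mem (interleave s d) \<psi>"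
    using assms(2) unfolding definable_def by auto
  define f where "f n = (if even n then n else 2 * n - 1)" for n :: nat
  define g where "g n = (if even n then n else 2 * n + 1)" for n :: nat
  have inj_f: "inj f"
    by (rule injI) (auto simp: f_def split: if_splits elim!: evenE oddE, presburger+)
  have inj_g: "inj g"
    by (rule injI) (auto simp: g_def split: if_splits elim!: evenE oddE, presburger+)
  have "interleave s (interleave c d) (f (Suc (2 * n))) = c n" for s n
    using interleave_simps(3)[of s "interleave c d" "2 * n"] by (simp add: f_def)
  then have f: "(\<lambda>n. interleave s (interleave c d) (f n)) = interleave s c" for s
    by (intro interleave_eqI[symmetric]) (simp_all, simp add: f_def)
  have "interleave s (interleave c d) (g (Suc (2 * n))) = d n" for s n
    using interleave_simps(3)[of s "interleave c d" "Suc (2 * n)"] by (simp add: g_def)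
  then have g: "(\<lambda>n. interleave s (interleave c d) (g n)) = interleave s d" for s
    by (intro interleave_eqI[symmetric]) (simp_all, simp add: g_def)
  have "\<forall>s. P s \<and> Q s \<longleftrightarrow>
      sat mem (interleave s (interleave c d)) (Conj (rename f \<phi>) (rename g \<psi>))"
    by (simp add: sat_rename inj_f inj_g f g 1 2)
  then show ?thesis unfolding definable_def by blast
qed

lemma definable_disj [definable_intros]:
  assumes "definable P" "definable Q" shows "definable (\<lambda>s. P s \<or> Q s)"
  by (rule definable_cong[OF definable_not[OF definable_conj[OF definable_not definable_not]]],
      rule assms, rule assms) blast

lemma definable_imp [definable_intros]:
  assumes "definable P" "definable Q" shows "definable (\<lambda>s. P s \<longrightarrow> Q s)"
  by (rule definable_cong[OF definable_disj[OF definable_not]], rule assms, rule assms) blast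

lemma definable_iff [definable_intros]:
  assumes "definable P" "definable Q" shows "definable (\<lambda>s. P s \<longleftrightarrow> Q s)"
  by (rule definable_cong[OF definable_conj[OF definable_imp definable_imp], of P Q Q P],
      (rule assms)+) blast

text \<open>
  Quantifiers follow de Bruijn: the bound variable becomes variable \<open>0\<close> of the body and all others
  move up. Stated this way, the rule applies by higher-order pattern unification.
\<close>

lemma definable_all [definable_intros]:
  assumes "definable (\<lambda>s. P (\<lambda>n. s (Suc n)) (s 0))"
  shows "definable (\<lambda>s. \<forall>x. P s x)"
proof -
  obtain \<phi> c where 1: "\<And>s. P (\<lambda>n. s (Suc n)) (s 0) \<longleftrightarrow> sat mem (interleave s c) \<phi>"
    using assms(1) unfolding definable_def by auto
  \<comment> \<open>The parameters move up by one odd place, which frees variable 1 for the quantifier.\<close>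
  define f where "f n = (if n = 0 then 1 else if even n then n - 2 else n + 2)" for n :: nat
  have inj: "inj f"
    by (rule injI) (auto simp: f_def split: if_splits elim!: evenE oddE, presburger+)
  define d where "d n = (case n of 0 \<Rightarrow> undefined | Suc k \<Rightarrow> c k)" for n
  have *: "(\<lambda>n. ((interleave s d)(1 := x)) (f n)) = interleave (case_nat x s) c" for s x
  proof (rule interleave_eqI[symmetric])
    fix n
    show "case_nat x s n = ((interleave s d)(1 := x)) (f (2 * n))"
      by (cases n) (auto simp: f_def split: nat.split)
    show "c n = ((interleave s d)(1 := x)) (f (Suc (2 * n)))"
      using interleave_simps(3)[of s d "Suc n"] by (simp add: f_def d_def)
  qed
  have "P s x \<longleftrightarrow> sat mem (interleave (case_nat x s) c) \<phi>" for s x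
    using 1[of "case_nat x s"] by simp
  then have "\<forall>s. (\<forall>x. P s x) \<longleftrightarrow> sat mem (interleave s d) (Forall 1 (rename f \<phi>))"
    by (simp only: sat.simps sat_rename[OF inj] *) simp
  then show ?thesis unfolding definable_def by blast
qed

lemma definable_ex [definable_intros]:
  assumes "definable (\<lambda>s. P (\<lambda>n. s (Suc n)) (s 0))"
  shows "definable (\<lambda>s. \<exists>x. P s x)"
  by (rule definable_cong[OF definable_not[OF definable_all[OF definable_not]], of P],
      rule assms) blast

lemma definable_reindex:
  assumes "definable P" and \<theta>: "inj \<theta>"
  shows "definable (\<lambda>s. P (\<lambda>n. s (\<theta> n)))"
proof -
  obtain \<phi> c where 1: "\<And>s. P s \<longleftrightarrow> sat mem (interleave s c) \<phi>"
    using assms(1) unfolding definable_def by auto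
  define f where "f n = (if even n then 2 * \<theta> (n div 2) else n)" for n
  have f: "f (2 * n) = 2 * \<theta> n" "f (Suc (2 * n)) = Suc (2 * n)" for n
    by (simp_all add: f_def)
  have "inj f"
  proof
    fix m n assume eq: "f m = f n"
    have "even (f m) = even m" "even (f n) = even n" by (simp_all add: f_def)
    then have "even m = even n" using eq by simp
    then show "m = n"
      using eq injD[OF \<theta>] by (cases "even n") (auto simp: f_def elim!: evenE)
  qed
  moreover have "(\<lambda>n. interleave s c (f n)) = interleave (\<lambda>n. s (\<theta> n)) c" for s
    by (rule interleave_eqI[symmetric]) (simp_all add: f)
  ultimately have "\<forall>s. P (\<lambda>n. s (\<theta> n)) \<longleftrightarrow> sat mem (interleave s c) (rename f \<phi>)"
    by (simp add: sat_rename 1)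
  then show ?thesis unfolding definable_def by blast
qed

lemma definable_term_shift:
  assumes "definable_term t"
  shows "definable_term (\<lambda>s. t (\<lambda>n. s (Suc n)))"
proof -
  have "inj (case_nat 0 (\<lambda>n. Suc (Suc n)))" by (rule injI) (auto split: nat.splits)
  from definable_reindex[OF assms[unfolded definable_term_def] this]
  show ?thesis unfolding definable_term_def by simp
qed

lemma definable_const [definable_intros]: "definable (\<lambda>s. b)"
proof -
  have "definable (\<lambda>s. s 0 = s 0)" "definable (\<lambda>s. s 0 \<noteq> s 0)"
    unfolding definable_def
    by (rule exI[of _ "Equal 0 0"], simp) (rule exI[of _ "Neg (Equal 0 0)"], simp)
  then show ?thesis by (cases b) auto
qed

lemma definable_term_var [definable_intros]: "definable_term (\<lambda>s. s i)"
  unfolding definable_term_def definable_def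
  by (rule exI[of _ "Equal 0 (2 * Suc i)"]) (simp only: sat.simps interleave_simps, simp)

lemma definable_term_param [definable_intros]: "definable_term (\<lambda>s. c)"
  unfolding definable_term_def definable_def
  by (rule exI[of _ "Equal 0 (Suc (2 * 0))"], rule exI[of _ "\<lambda>_. c"])
    (simp only: sat.simps interleave_simps, simp)

lemma definable_subst1:
  assumes "definable (\<lambda>s. Q (s 0))" "definable_term a"
  shows "definable (\<lambda>s. Q (a s))"
proof -
  have "definable (\<lambda>s. \<exists>x. x = a s \<and> Q x)"
    by (intro definable_intros assms assms(2)[unfolded definable_term_def])
  then show ?thesis by simp
qed

text \<open>
  Formulas have no terms besides variables, so substitution is expressed by existential quantifiers
  over the values of the terms. The last argument is quantified first: then the first
  argument ends up as variable \<open>0\<close>.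
\<close>

lemma definable_subst2:
  assumes "definable (\<lambda>s. Q (s 0) (s (Suc 0)))" "definable_term a" "definable_term b"
  shows "definable (\<lambda>s. Q (a s) (b s))"
proof -
  have "definable (\<lambda>s. \<exists>y. y = b s \<and> (\<exists>x. x = a s \<and> Q x y))"
    by (intro definable_intros assms assms(3)[unfolded definable_term_def]
        assms(2)[THEN definable_term_shift, unfolded definable_term_def])
  then show ?thesis by simp
qed

lemma definable_subst3:
  assumes "definable (\<lambda>s. Q (s 0) (s (Suc 0)) (s (Suc (Suc 0))))"
    "definable_term a" "definable_term b" "definable_term c"
  shows "definable (\<lambda>s. Q (a s) (b s) (c s))"
proof -
  have "definable (\<lambda>s. \<exists>z. z = c s \<and> (\<exists>y. y = b s \<and> (\<exists>x. x = a s \<and> Q x y z)))"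
    by (intro definable_intros assms assms(4)[unfolded definable_term_def]
        assms(3)[THEN definable_term_shift, unfolded definable_term_def]
        assms(2)[THEN definable_term_shift, THEN definable_term_shift, unfolded definable_term_def])
  then show ?thesis by simp
qed

lemma definable_term_app1:
  assumes "definable (\<lambda>s. s 0 = f (s (Suc 0)))" "definable_term a"
  shows "definable_term (\<lambda>s. f (a s))"
  unfolding definable_term_def
  by (rule definable_subst2[where Q = "\<lambda>z x. z = f x"])
    (intro assms definable_intros definable_term_shift)+

lemma definable_term_app2:
  assumes "definable (\<lambda>s. s 0 = f (s (Suc 0)) (s (Suc (Suc 0))))"
    "definable_term a" "definable_term b"
  shows "definable_term (\<lambda>s. f (a s) (b s))"
  unfolding definable_term_def
  by (rule definable_subst3[where Q = "\<lambda>z x y. z = f x y"])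
    (intro assms definable_intros definable_term_shift)+

lemma definable_elem [definable_intros]:
  assumes "definable_term a" "definable_term b"
  shows "definable (\<lambda>s. a s \<in> El (b s))"
proof (rule definable_subst2[OF _ assms, where Q = "\<lambda>x y. x \<in> El y"])
  show "definable (\<lambda>s. s 0 \<in> El (s (Suc 0)))"
    unfolding definable_def elts_def
    by (rule exI[of _ "Mem (2 * 0) (2 * 1)"]) (simp only: sat.simps interleave_simps, simp)
qed

lemma definable_eq [definable_intros]:
  assumes "definable_term a" "definable_term b"
  shows "definable (\<lambda>s. a s = b s)"
proof (rule definable_subst2[OF _ assms, where Q = "\<lambda>x y. x = y"])
  show "definable (\<lambda>s. s 0 = s (Suc 0))"
    unfolding definable_def
    by (rule exI[of _ "Equal (2 * 0) (2 * 1)"]) (simp only: sat.simps interleave_simps, simp)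
qed

lemma definable_ball [definable_intros]:
  assumes "definable_term a" "definable (\<lambda>s. P (\<lambda>n. s (Suc n)) (s 0))"
  shows "definable (\<lambda>s. \<forall>x\<in>El (a s). P s x)"
  unfolding Ball_def by (intro definable_intros assms definable_term_shift)

lemma definable_bex [definable_intros]:
  assumes "definable_term a" "definable (\<lambda>s. P (\<lambda>n. s (Suc n)) (s 0))"
  shows "definable (\<lambda>s. \<exists>x\<in>El (a s). P s x)"
  unfolding Bex_def by (intro definable_intros assms definable_term_shift)

lemma definable_subset [definable_intros]:
  assumes "definable_term a" "definable_term b"
  shows "definable (\<lambda>s. El (a s) \<subseteq> El (b s))"
  unfolding subset_iff by (intro definable_intros assms definable_term_shift)

section \<open>Sets\<close>

lemma ext_El: "El a = El b \<Longrightarrow> a = b"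
  using ZF by (auto simp: ZF_model_def extensionality_axiom_def)

text \<open>
  From here on definability is the only link to the schema, and formulas no longer appear.
\<close>

lemma separation:
  assumes "definable (\<lambda>s. P (s 0))"
  shows "\<exists>b. El b = {x \<in> El a. P x}"
proof -
  obtain \<phi> c where 1: "\<And>s. P (s 0) \<longleftrightarrow> sat mem (interleave s c) \<phi>"
    using assms(1) unfolding definable_def by blast
  define t where "t = interleave undefined c"
  have "interleave (undefined(0:=x)) c = t(0 := x)" for x
    by (auto simp: fun_eq_iff t_def interleave_def)
  then have "P x \<longleftrightarrow> sat mem (t(0 := x)) \<phi>" for x
    using 1[of "undefined(0 := x)"] by simp
  then show ?thesis
    using ZF by (simp add: ZF_model_def separation_schema_def)
qed

lemma pairing: "\<exists>c. El c = {a, b}"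
  using ZF by (auto simp: ZF_model_def pairing_axiom_def)

lemma power_set: "\<exists>p. El p = {b. El b \<subseteq> El a}"
  using ZF by (auto simp: ZF_model_def power_set_axiom_def)

lemma union2: "\<exists>u. El u = El a \<union> El b"
proof -
  obtain c where "El c = {a, b}" using pairing by blast
  moreover obtain u where "El u = (\<Union>x\<in>El c. El x)"
    using ZF unfolding ZF_model_def union_axiom_def by blast
  ultimately show ?thesis by auto
qed

lemma not_self: "x \<notin> El x"
proof
  assume "x \<in> El x"
  obtain c where "El c = {x, x}" using pairing by blast
  then show False
    using ZF \<open>x \<in> El x\<close> unfolding ZF_model_def foundation_axiom_def by force
qed

definition emptyset :: "'m" where "emptyset = (THE e. El e = {})"
definition succ :: "'m \<Rightarrow> 'm" where "succ n = (THE s. El s = insert n (El n))"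
definition powerset :: "'m \<Rightarrow> 'm" where "powerset a = (THE p. El p = {b. El b \<subseteq> El a})"
definition pair :: "'m \<Rightarrow> 'm \<Rightarrow> 'm" where "pair a b = (THE p. is_pair mem p a b)"

lemma El_the: "\<exists>b. El b = A \<Longrightarrow> El (THE b. El b = A) = A"
  using ext_El by (metis (mono_tags, lifting) theI)

lemma El_empty [simp]: "El emptyset = {}"
  unfolding emptyset_def
  using separation[of "\<lambda>_. False"] by (intro El_the) (auto intro: definable_intros)

lemma El_succ [simp]: "El (succ n) = insert n (El n)"
proof -
  obtain c where "El c = {n, n}" using pairing by blast
  moreover obtain u where "El u = El c \<union> El n" using union2 by blast
  ultimately show ?thesis unfolding succ_def by (intro El_the) auto
qed

lemma El_powerset [simp]: "El (powerset a) = {b. El b \<subseteq> El a}"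
  unfolding powerset_def using power_set by (intro El_the) auto

lemma ex_pair: "\<exists>p. is_pair mem p a b"
proof -
  obtain c where c: "El c = {a, a}" using pairing by blast
  obtain d where d: "El d = {a, b}" using pairing by blast
  obtain p where p: "El p = {c, d}" using pairing by blast
  have "is_pair mem p a b" unfolding is_pair_def p
    using c d ext_El by auto
  then show ?thesis by blast
qed

lemma is_pair_unique: "is_pair mem p a b \<Longrightarrow> is_pair mem q a b \<Longrightarrow> p = q"
  unfolding is_pair_def using ext_El by auto

lemma is_pair_pair: "is_pair mem (pair a b) a b"
  unfolding pair_def using ex_pair is_pair_unique by (metis theI)

text \<open>
  Pairs exist and are unique, so \<open>is_pair\<close> can be replaced by a total operation everywhere.
\<close>

lemma is_pair_iff: "is_pair mem p a b \<longleftrightarrow> p = pair a b"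
  using is_pair_pair is_pair_unique by blast

lemma pair_inject [simp]: "pair a b = pair c d \<longleftrightarrow> a = c \<and> b = d"
proof
  assume eq: "pair a b = pair c d"
  obtain u where u: "El u = {a, a}" using pairing by blast
  obtain v where v: "El v = {a, b}" using pairing by blast
  obtain y where y: "El y = {c, d}" using pairing by blast
  have mem_pair: "z \<in> El (pair x y) \<longleftrightarrow> El z = {x} \<or> El z = {x, y}" for x y z
    using is_pair_pair[of x y] unfolding is_pair_def by simp
  have "u \<in> El (pair c d)" "v \<in> El (pair c d)"
    unfolding eq[symmetric] mem_pair by (simp_all add: u v)
  moreover have "y \<in> El (pair a b)"
    unfolding eq mem_pair by (simp add: y)
  ultimately have "El u = {c} \<or> El u = {c, d}" "El v = {c} \<or> El v = {c, d}"
    "El y = {a} \<or> El y = {a, b}"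
    unfolding mem_pair by simp_all
  then have "({a} = {c} \<or> {a} = {c,d}) \<and> ({a,b} = {c} \<or> {a,b} = {c,d})
    \<and> ({c,d} = {a} \<or> {c,d} = {a,b})"
    unfolding u v y by auto
  then show "a = c \<and> b = d" by (auto simp: doubleton_eq_iff)
qed simp

lemma is_pair_definable [THEN definable_subst3, definable_intros]:
  "definable (\<lambda>s. is_pair mem (s 0) (s (Suc 0)) (s (Suc (Suc 0))))"
  unfolding is_pair_def set_eq_iff mem_Collect_eq insert_iff empty_iff
  by (intro definable_intros)

lemma pair_definable [THEN definable_term_app2, definable_intros]:
  "definable (\<lambda>s. s 0 = pair (s (Suc 0)) (s (Suc (Suc 0))))"
  unfolding is_pair_iff[symmetric]
  by (intro definable_intros)

lemma related_iff: "related mem r x y \<longleftrightarrow> pair x y \<in> El r"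
  unfolding related_def is_pair_iff by auto

lemma product: "\<exists>p. El p = {z. \<exists>x\<in>El a. \<exists>y\<in>El b. z = pair x y}"
proof -
  obtain u where u: "El u = El a \<union> El b" using union2 by blast
  have sub: "pair x y \<in> El (powerset (powerset u))" if "x \<in> El a" "y \<in> El b" for x y
    using is_pair_pair[of x y] that unfolding is_pair_def by (auto simp: u)
  have "\<exists>p. El p = {z \<in> El (powerset (powerset u)). \<exists>x\<in>El a. \<exists>y\<in>El b. z = pair x y}"
    by (rule separation) (intro definable_intros)
  then obtain p where p: "El p = {z \<in> El (powerset (powerset u)). \<exists>x\<in>El a. \<exists>y\<in>El b. z = pair x y}"
    by blast
  show ?thesis using sub by (intro exI[of _ p]) (auto simp del: El_powerset simp: p)
qed

lemma ex1_iff: "(\<exists>!x. P x) \<longleftrightarrow> (\<exists>x. P x \<and> (\<forall>y. P y \<longrightarrow> y = x))"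
  by blast

section \<open>Functions\<close>

text \<open>
  A function of the model is given by its values \<open>t\<close>, which need not be definable as an operation;
  it suffices that some definable relation \<open>Q\<close> describes its graph on \<open>a \<times> b\<close>.
\<close>

lemma function_exists:
  assumes Q: "definable (\<lambda>s. Q (s 0) (s (Suc 0)))"
    and t: "\<And>x. x \<in> El a \<Longrightarrow> t x \<in> El b"
    and Qt: "\<And>x y. x \<in> El a \<Longrightarrow> y \<in> El b \<Longrightarrow> Q x y \<longleftrightarrow> y = t x"
  shows "\<exists>f. is_function mem f a b \<and> (\<forall>x\<in>El a. app mem f x = t x)"
proof -
  obtain p where p: "El p = {z. \<exists>x\<in>El a. \<exists>y\<in>El b. z = pair x y}"
    using product by blast
  have "\<exists>f. El f = {z \<in> El p. \<exists>x. \<exists>y. z = pair x y \<and> Q x y}"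
    by (rule separation) (intro definable_intros Q[THEN definable_subst2])
  then obtain f where f: "El f = {z \<in> El p. \<exists>x. \<exists>y. z = pair x y \<and> Q x y}" by blast
  have rel: "related mem f x y \<longleftrightarrow> x \<in> El a \<and> y = t x" for x y
    unfolding related_iff f p using Qt t by auto
  have "is_function mem f a b"
    unfolding is_function_def rel is_pair_iff f p by auto
  moreover have "app mem f x = t x" if "x \<in> El a" for x
    unfolding app_def rel using that by simp
  ultimately show ?thesis by blast
qed

lemma related_app:
  assumes "is_function mem f a b" "x \<in> El a"
  shows "related mem f x y \<longleftrightarrow> y = app mem f x"
proof -
  have "\<exists>!y. related mem f x y" using assms unfolding is_function_def by blast
  then show ?thesis unfolding app_def by (metis theI')
qed

lemma app_closed:
  assumes "is_function mem f a b" "x \<in> El a"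
  shows "app mem f x \<in> El b"
proof -
  have "related mem f x (app mem f x)" using related_app[OF assms] by simp
  then show ?thesis
    using assms(1) unfolding is_function_def related_def by (metis is_pair_iff pair_inject)
qed

text \<open>
  Function application with a default value. A description \<open>THE y. P y\<close> without a unique witness is
  an unknown value that might depend on \<open>P\<close>, hence on the arguments, in a way no formula
  expresses; the default makes application a definable operation for all arguments.
\<close>

definition ap :: "'m \<Rightarrow> 'm \<Rightarrow> 'm" where
  "ap f x = (if \<exists>!y. related mem f x y then app mem f x else f)"

lemma app_eq_ap: "is_function mem f a b \<Longrightarrow> x \<in> El a \<Longrightarrow> app mem f x = ap f x"
  unfolding ap_def is_function_def by simp

lemma ap_closed: "is_function mem f a b \<Longrightarrow> x \<in> El a \<Longrightarrow> ap f x \<in> El b"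
  using app_closed app_eq_ap by metis

lemma related_definable [THEN definable_subst3, definable_intros]:
  "definable (\<lambda>s. related mem (s 0) (s (Suc 0)) (s (Suc (Suc 0))))"
  unfolding related_iff by (intro definable_intros)

lemma ap_definable [THEN definable_term_app2, definable_intros]:
  "definable (\<lambda>s. s 0 = ap (s (Suc 0)) (s (Suc (Suc 0))))"
proof (rule definable_cong)
  let ?Q = "\<lambda>y f x. (related mem f x y \<and> (\<forall>z. related mem f x z \<longrightarrow> z = y)) \<or>
     \<not> (\<exists>y. related mem f x y \<and> (\<forall>z. related mem f x z \<longrightarrow> z = y)) \<and> y = f"
  show "definable (\<lambda>s. ?Q (s 0) (s (Suc 0)) (s (Suc (Suc 0))))"
    by (intro definable_intros)
  show "?Q (s 0) (s (Suc 0)) (s (Suc (Suc 0))) \<longleftrightarrow> s 0 = ap (s (Suc 0)) (s (Suc (Suc 0)))" for s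
  proof (cases "\<exists>!y. related mem (s (Suc 0)) (s (Suc (Suc 0))) y")
    case True
    then obtain v where "related mem (s (Suc 0)) (s (Suc (Suc 0))) = (\<lambda>y. y = v)" by blast
    then show ?thesis unfolding ap_def app_def by auto
  next
    case False
    then show ?thesis unfolding ap_def by auto
  qed
qed

lemma is_function_definable [THEN definable_subst3, definable_intros]:
  "definable (\<lambda>s. is_function mem (s 0) (s (Suc 0)) (s (Suc (Suc 0))))"
  unfolding is_function_def ex1_iff by (intro definable_intros)

section \<open>Natural numbers\<close>

lemma is_inductive_iff:
  "is_inductive mem w \<longleftrightarrow> emptyset \<in> El w \<and> (\<forall>n\<in>El w. succ n \<in> El w)"
  unfolding is_inductive_def using ext_El El_empty El_succ by metis

lemma succ_definable [THEN definable_term_app1, definable_intros]: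
  "definable (\<lambda>s. s 0 = succ (s (Suc 0)))"
proof (rule definable_cong)
  show "definable (\<lambda>s. \<forall>z. z \<in> El (s 0) \<longleftrightarrow> z = s (Suc 0) \<or> z \<in> El (s (Suc 0)))"
    by (intro definable_intros)
  show "(\<forall>z. z \<in> El (s 0) \<longleftrightarrow> z = s (Suc 0) \<or> z \<in> El (s (Suc 0))) \<longleftrightarrow> s 0 = succ (s (Suc 0))" for s
    using ext_El[of "s 0" "succ (s (Suc 0))"] by auto
qed

definition omega :: "'m" where "omega = (THE w. is_omega mem w)"

text \<open>
  The intersection of all inductive sets, taken inside one inductive set, is the unique \<open>\<omega>\<close>.
\<close>

lemma is_omega_iff: "is_omega mem w \<longleftrightarrow> w = omega"
proof -
  obtain v where v: "is_inductive mem v"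
    using ZF by (auto simp: ZF_model_def infinity_axiom_def)
  have "\<exists>w. El w = {n \<in> El v. \<forall>u. is_inductive mem u \<longrightarrow> n \<in> El u}"
    unfolding is_inductive_iff by (rule separation) (intro definable_intros)
  then obtain w where "El w = {n \<in> El v. \<forall>u. is_inductive mem u \<longrightarrow> n \<in> El u}" by blast
  then have "is_omega mem w"
    unfolding is_omega_def using v by (auto simp: is_inductive_iff)
  then have "\<exists>!w. is_omega mem w"
    unfolding is_omega_def by (meson ext_El subset_antisym)
  then show ?thesis unfolding omega_def by (metis theI')
qed

lemma zero_omega [simp]: "emptyset \<in> El omega"
  and succ_omega [simp]: "n \<in> El omega \<Longrightarrow> succ n \<in> El omega"
  using is_omega_iff[of omega] unfolding is_omega_def is_inductive_iff by auto

lemma omega_induct [consumes 1, case_names definable zero succ]: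
  assumes "n \<in> El omega" and P: "definable (\<lambda>s. P (s 0))"
    and "P emptyset" "\<And>n. n \<in> El omega \<Longrightarrow> P n \<Longrightarrow> P (succ n)"
  shows "P n"
proof -
  have "\<exists>w. El w = {n \<in> El omega. P n}" by (rule separation) (rule P)
  then obtain w where w: "El w = {n \<in> El omega. P n}" by blast
  then have "is_inductive mem w" using assms unfolding is_inductive_iff by simp
  then show ?thesis using is_omega_iff[of omega] w assms(1) unfolding is_omega_def by blast
qed

lemma mem_omega: "n \<in> El omega \<Longrightarrow> \<forall>m\<in>El n. m \<in> El omega"
proof (induction n rule: omega_induct)
  case definable show ?case by (intro definable_intros)
qed auto

lemma succ_mem_succ: "n \<in> El omega \<Longrightarrow> \<forall>m\<in>El n. succ m \<in> El (succ n)"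
proof (induction n rule: omega_induct)
  case definable show ?case by (intro definable_intros)
qed auto

lemma zero_mem_succ: "n \<in> El omega \<Longrightarrow> emptyset \<in> El (succ n)"
proof (induction n rule: omega_induct)
  case definable show ?case by (intro definable_intros)
qed auto

end

locale ZF_real = ZF mem for mem :: "'m \<Rightarrow> 'm \<Rightarrow> bool" +
  fixes R :: "'m ordered_field_structure"
  assumes real_line: "real_line mem R"
begin

section \<open>Arithmetic of the real line\<close>

abbreviation Reals :: "'m set" where "Reals \<equiv> El (Dom R)"
abbreviation real_less :: "'m \<Rightarrow> 'm \<Rightarrow> bool" (infix "\<prec>" 50) where
  "x \<prec> y \<equiv> related mem (Less R) x y"
abbreviation real_plus :: "'m \<Rightarrow> 'm \<Rightarrow> 'm" (infixl "[+]" 65) where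
  "x [+] y \<equiv> ap (Add R) (pair x y)"
abbreviation real_times :: "'m \<Rightarrow> 'm \<Rightarrow> 'm" (infixl "[*]" 70) where
  "x [*] y \<equiv> ap (Mul R) (pair x y)"
abbreviation r0 :: "'m" where "r0 \<equiv> Zer R"
abbreviation r1 :: "'m" where "r1 \<equiv> One R"

lemma app2_eq:
  assumes "is_product mem P a b" "is_function mem f P c" "x \<in> El a" "y \<in> El b"
  shows "app2 mem f x y = ap f (pair x y)" "ap f (pair x y) \<in> El c"
proof -
  have "pair x y \<in> El P"
    using assms unfolding is_product_def is_pair_iff by auto
  then show "app2 mem f x y = ap f (pair x y)" "ap f (pair x y) \<in> El c"
    using assms(2) app_eq_ap ap_closed unfolding app2_def is_pair_iff by auto
qed

lemma plus_times:
  assumes "x \<in> Reals" "y \<in> Reals"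
  shows "app2 mem (Add R) x y = x [+] y" "app2 mem (Mul R) x y = x [*] y"
    "x [+] y \<in> Reals" "x [*] y \<in> Reals"
  using real_line app2_eq assms unfolding real_line_def by metis+

lemmas plus_closed [simp, intro] = plus_times(3)
lemmas times_closed [simp, intro] = plus_times(4)

lemma field_real: "field (field_ring mem R)"
  using real_line unfolding real_line_def by blast

lemma zero_closed [simp]: "r0 \<in> Reals" and one_closed [simp]: "r1 \<in> Reals"
  and one_neq_zero: "r1 \<noteq> r0"
proof -
  interpret field "field_ring mem R" by (rule field_real)
  show "r0 \<in> Reals" "r1 \<in> Reals" "r1 \<noteq> r0"
    using zero_closed one_closed one_not_zero by (simp_all add: field_ring_def)
qed

lemma
  assumes "x \<in> Reals" "y \<in> Reals"
  shows plus_comm: "x [+] y = y [+] x"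
    and times_comm: "x [*] y = y [*] x"
    and plus_zero [simp]: "x [+] r0 = x" and zero_plus [simp]: "r0 [+] x = x"
    and times_one [simp]: "x [*] r1 = x" and one_times [simp]: "r1 [*] x = x"
    and times_zero [simp]: "x [*] r0 = r0" and zero_times [simp]: "r0 [*] x = r0"
    and ex_uminus: "\<exists>z\<in>Reals. x [+] z = r0"
    and ex_inverse: "x \<noteq> r0 \<Longrightarrow> \<exists>z\<in>Reals. x [*] z = r1"
proof -
  interpret field "field_ring mem R" by (rule field_real)
  note simps = field_ring_def plus_times
  show "x [+] y = y [+] x" using a_comm[of x y] assms by (simp add: simps)
  show "x [*] y = y [*] x" using m_comm[of x y] assms by (simp add: simps)
  show "x [+] r0 = x" using r_zero[of x] assms by (simp add: simps)
  show "r0 [+] x = x" using l_zero[of x] assms by (simp add: simps)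
  show "x [*] r1 = x" using r_one[of x] assms by (simp add: simps)
  show "r1 [*] x = x" using l_one[of x] assms by (simp add: simps)
  show "x [*] r0 = r0" using r_null[of x] assms by (simp add: simps)
  show "r0 [*] x = r0" using l_null[of x] assms by (simp add: simps)
  show "\<exists>z\<in>Reals. x [+] z = r0"
    using r_neg[of x] a_inv_closed[of x] assms plus_times(1) by (metis simps(1) partial_object.select_convs(1) ring.simps)
  show "\<exists>z\<in>Reals. x [*] z = r1" if "x \<noteq> r0"
  proof -
    have "x \<in> Units (field_ring mem R)"
      using field_Units that assms by (simp add: field_ring_def)
    then show ?thesis using assms by (auto simp: Units_def simps)
  qed
qed

lemma
  assumes "x \<in> Reals" "y \<in> Reals" "z \<in> Reals"
  shows plus_assoc: "x [+] y [+] z = x [+] (y [+] z)"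
    and distrib: "(x [+] y) [*] z = x [*] z [+] y [*] z"
proof -
  interpret field "field_ring mem R" by (rule field_real)
  note simps = field_ring_def plus_times
  show "x [+] y [+] z = x [+] (y [+] z)" using a_assoc[of x y z] assms by (simp add: simps)
  show "(x [+] y) [*] z = x [*] z [+] y [*] z" using l_distr[of x y z] assms by (simp add: simps)
qed

lemmas real_line_unfolded = real_line[unfolded real_line_def less_real_def]

lemma less_irrefl: "x \<in> Reals \<Longrightarrow> \<not> x \<prec> x"
  using real_line_unfolded by (elim conjE) (erule (1) bspec)

lemma less_trans: "x \<prec> y \<Longrightarrow> y \<prec> z \<Longrightarrow> x \<in> Reals \<Longrightarrow> y \<in> Reals \<Longrightarrow> z \<in> Reals \<Longrightarrow> x \<prec> z"
proof -
  have "\<forall>x\<in>Reals. \<forall>y\<in>Reals. \<forall>z\<in>Reals. x \<prec> y \<longrightarrow> y \<prec> z \<longrightarrow> x \<prec> z"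
    using real_line_unfolded by (elim conjE)
  then show "x \<prec> y \<Longrightarrow> y \<prec> z \<Longrightarrow> x \<in> Reals \<Longrightarrow> y \<in> Reals \<Longrightarrow> z \<in> Reals \<Longrightarrow> x \<prec> z"
    by blast
qed

lemma less_linear: "x \<in> Reals \<Longrightarrow> y \<in> Reals \<Longrightarrow> x \<prec> y \<or> x = y \<or> y \<prec> x"
proof -
  have "\<forall>x\<in>Reals. \<forall>y\<in>Reals. x \<prec> y \<or> x = y \<or> y \<prec> x"
    using real_line_unfolded by (elim conjE)
  then show "x \<in> Reals \<Longrightarrow> y \<in> Reals \<Longrightarrow> x \<prec> y \<or> x = y \<or> y \<prec> x" by blast
qed

lemma less_asym: "x \<prec> y \<Longrightarrow> x \<in> Reals \<Longrightarrow> y \<in> Reals \<Longrightarrow> \<not> y \<prec> x"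
  using less_trans less_irrefl by blast

lemma le_less_trans: "\<not> y \<prec> x \<Longrightarrow> y \<prec> z \<Longrightarrow> x \<in> Reals \<Longrightarrow> y \<in> Reals \<Longrightarrow> z \<in> Reals \<Longrightarrow> x \<prec> z"
  using less_trans less_linear by metis

lemma less_le_trans: "x \<prec> y \<Longrightarrow> \<not> z \<prec> y \<Longrightarrow> x \<in> Reals \<Longrightarrow> y \<in> Reals \<Longrightarrow> z \<in> Reals \<Longrightarrow> x \<prec> z"
  using less_trans less_linear by metis

lemma plus_mono: "x \<prec> y \<Longrightarrow> x \<in> Reals \<Longrightarrow> y \<in> Reals \<Longrightarrow> z \<in> Reals \<Longrightarrow> x [+] z \<prec> y [+] z"
proof -
  have "\<forall>x\<in>Reals. \<forall>y\<in>Reals. \<forall>z\<in>Reals.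
      x \<prec> y \<longrightarrow> app2 mem (Add R) x z \<prec> app2 mem (Add R) y z"
    using real_line_unfolded by (elim conjE)
  then show "x \<prec> y \<Longrightarrow> x \<in> Reals \<Longrightarrow> y \<in> Reals \<Longrightarrow> z \<in> Reals \<Longrightarrow> x [+] z \<prec> y [+] z"
    using plus_times(1) by simp
qed

lemma times_pos: "r0 \<prec> x \<Longrightarrow> r0 \<prec> y \<Longrightarrow> x \<in> Reals \<Longrightarrow> y \<in> Reals \<Longrightarrow> r0 \<prec> x [*] y"
proof -
  have "\<forall>x\<in>Reals. \<forall>y\<in>Reals. r0 \<prec> x \<longrightarrow> r0 \<prec> y \<longrightarrow> r0 \<prec> app2 mem (Mul R) x y"
    using real_line_unfolded by (elim conjE)
  then show "r0 \<prec> x \<Longrightarrow> r0 \<prec> y \<Longrightarrow> x \<in> Reals \<Longrightarrow> y \<in> Reals \<Longrightarrow> r0 \<prec> x [*] y"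
    using plus_times(2) by simp
qed

lemma supremum_exists:
  assumes "El A \<subseteq> Reals" "El A \<noteq> {}" "u \<in> Reals" "\<forall>x\<in>El A. \<not> u \<prec> x"
  shows "\<exists>u\<in>Reals. (\<forall>x\<in>El A. \<not> u \<prec> x) \<and> (\<forall>v\<in>Reals. (\<forall>x\<in>El A. \<not> v \<prec> x) \<longrightarrow> \<not> v \<prec> u)"
proof -
  have "\<forall>A. El A \<subseteq> Reals \<and> El A \<noteq> {} \<and> (\<exists>u\<in>Reals. \<forall>x\<in>El A. \<not> u \<prec> x) \<longrightarrow>
      (\<exists>u\<in>Reals. (\<forall>x\<in>El A. \<not> u \<prec> x) \<and>
         (\<forall>v\<in>Reals. (\<forall>x\<in>El A. \<not> v \<prec> x) \<longrightarrow> \<not> v \<prec> u))"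
    using real_line_unfolded by (elim conjE)
  then show ?thesis by (rule allE[where x = A]) (erule mp, use assms in blast)
qed

lemma plus_cancel:
  assumes "x \<in> Reals" "y \<in> Reals" "c \<in> Reals" "d \<in> Reals" "c [+] d = r0"
  shows "x [+] c [+] d = x" "x [+] d [+] c = x"
  using assms by (simp_all add: plus_assoc plus_comm[of d c])

lemma less_plus_iff:
  assumes "x \<in> Reals" "y \<in> Reals" "c \<in> Reals" "d \<in> Reals" "c [+] d = r0"
  shows "x \<prec> y [+] c \<longleftrightarrow> x [+] d \<prec> y" "y [+] c \<prec> x \<longleftrightarrow> y \<prec> x [+] d"
proof -
  note c = plus_cancel[OF assms] plus_cancel[OF assms(2) assms(1) assms(3-5)]
  show "x \<prec> y [+] c \<longleftrightarrow> x [+] d \<prec> y"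
    using plus_mono[of x "y [+] c" d] plus_mono[of "x [+] d" y c] assms c by auto
  show "y [+] c \<prec> x \<longleftrightarrow> y \<prec> x [+] d"
    using plus_mono[of "y [+] c" x d] plus_mono[of y "x [+] d" c] assms c by auto
qed

lemma times_mono:
  assumes "x \<prec> y" "r0 \<prec> z" "x \<in> Reals" "y \<in> Reals" "z \<in> Reals"
  shows "x [*] z \<prec> y [*] z"
proof -
  obtain d where d: "d \<in> Reals" "x [+] d = r0" using ex_uminus[of x x] assms by auto
  have "r0 \<prec> y [+] d" using plus_mono[OF assms(1), of d] d assms by simp
  then have "r0 \<prec> (y [+] d) [*] z" using times_pos assms d by blast
  then have "r0 [+] x [*] z \<prec> (y [+] d) [*] z [+] x [*] z"
    using assms d by (intro plus_mono) auto
  moreover have "(y [+] d) [*] z [+] x [*] z = y [*] z"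
    using assms d by (simp add: distrib[symmetric]) (simp add: plus_assoc plus_comm[of d x])
  ultimately show ?thesis using assms by simp
qed

lemma zero_less_one: "r0 \<prec> r1"
proof (rule ccontr)
  assume "\<not> r0 \<prec> r1"
  then have lt: "r1 \<prec> r0" using less_linear[of r0 r1] one_neq_zero by auto
  obtain d where d: "d \<in> Reals" "r1 [+] d = r0" using ex_uminus[of r1 r1] by auto
  have "r0 \<prec> d" using plus_mono[OF lt, of d] d by simp
  then have "r1 [*] d \<prec> r0 [*] d" using times_mono[OF lt] d by simp
  then show False using \<open>r0 \<prec> d\<close> d less_asym by simp
qed

lemma less_plus: "r0 \<prec> c \<Longrightarrow> x \<in> Reals \<Longrightarrow> c \<in> Reals \<Longrightarrow> x \<prec> x [+] c"
  using plus_mono[of r0 c x] by (simp add: plus_comm)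

lemma ex_less: "x \<in> Reals \<Longrightarrow> \<exists>y\<in>Reals. y \<prec> x"
proof -
  assume x: "x \<in> Reals"
  obtain d where d: "d \<in> Reals" "r1 [+] d = r0" using ex_uminus[of r1 r1] by auto
  have "x [+] d \<prec> x [+] d [+] r1" using less_plus zero_less_one x d by simp
  then show ?thesis using plus_cancel[OF x x one_closed d] x d by (metis plus_closed)
qed

lemma ex_greater: "x \<in> Reals \<Longrightarrow> \<exists>y\<in>Reals. x \<prec> y"
  using less_plus zero_less_one plus_closed one_closed by blast

section \<open>A sequence of positive reals with limit zero\<close>

text \<open>
  \<open>nat_real n r\<close> says that \<open>r = n + 1\<close> in the real line. Instead of recursion on \<open>\<omega>\<close>, the least
  relation of the model that contains \<open>(0, 1)\<close> and is closed under \<open>(n, r) \<mapsto> (n + 1, r + 1)\<close> is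
  used; the bound \<open>\<omega> \<times> Reals\<close> makes it a set.
\<close>

definition nat_real :: "'m \<Rightarrow> 'm \<Rightarrow> bool" where
  "nat_real n r \<longleftrightarrow> n \<in> El omega \<and> r \<in> Reals \<and>
     (\<forall>C. pair emptyset r1 \<in> El C \<and>
        (\<forall>m\<in>El omega. \<forall>q\<in>Reals. pair m q \<in> El C \<longrightarrow> pair (succ m) (q [+] r1) \<in> El C) \<longrightarrow>
      pair n r \<in> El C)"

lemma nat_real_definable [THEN definable_subst2, definable_intros]:
  "definable (\<lambda>s. nat_real (s 0) (s (Suc 0)))"
  unfolding nat_real_def by (intro definable_intros)

lemma nat_real_zero: "nat_real emptyset r1"
  and nat_real_succ: "nat_real n r \<Longrightarrow> nat_real (succ n) (r [+] r1)"
  unfolding nat_real_def by auto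

lemma nat_real_carrier: "nat_real n r \<Longrightarrow> n \<in> El omega" "nat_real n r \<Longrightarrow> r \<in> Reals"
  unfolding nat_real_def by auto

lemma nat_real_induct [consumes 1, case_names definable zero succ]:
  assumes "nat_real n r" and P: "definable (\<lambda>s. P (s 0) (s (Suc 0)))"
    and "P emptyset r1" "\<And>n r. nat_real n r \<Longrightarrow> P n r \<Longrightarrow> P (succ n) (r [+] r1)"
  shows "P n r"
proof -
  obtain p where p: "El p = {z. \<exists>x\<in>El omega. \<exists>y\<in>Reals. z = pair x y}"
    using product by blast
  have "\<exists>C. El C = {z \<in> El p. \<exists>n r. z = pair n r \<and> nat_real n r \<and> P n r}"
    by (rule separation) (intro definable_intros P[THEN definable_subst2])
  then obtain C where C: "El C = {z \<in> El p. \<exists>n r. z = pair n r \<and> nat_real n r \<and> P n r}" by blast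
  have "pair emptyset r1 \<in> El C"
    unfolding C p using nat_real_zero assms(3) by auto
  moreover have "\<forall>m\<in>El omega. \<forall>q\<in>Reals. pair m q \<in> El C \<longrightarrow> pair (succ m) (q [+] r1) \<in> El C"
    unfolding C p using nat_real_succ assms(4) by auto
  ultimately have "pair n r \<in> El C"
    using assms(1) unfolding nat_real_def by blast
  then show ?thesis unfolding C by auto
qed

lemma nat_real_total: "n \<in> El omega \<Longrightarrow> \<exists>r. nat_real n r"
proof (induction n rule: omega_induct)
  case definable show ?case by (intro definable_intros)
qed (use nat_real_zero nat_real_succ in blast)+

lemma nat_real_comparison_zero:
  "nat_real m q \<Longrightarrow> m = emptyset \<and> q = r1 \<or> emptyset \<in> El m \<and> r1 \<prec> q"
proof (induction m q rule: nat_real_induct)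
  case definable show ?case by (intro definable_intros)
next
  case (succ n r)
  then have "n \<in> El omega" "r \<in> Reals" using nat_real_carrier by auto
  then show ?case
    using succ zero_mem_succ less_plus[OF zero_less_one] less_trans[of r1 r "r [+] r1"] by auto
qed simp

text \<open>
  One trichotomy gives at once that the relation is single-valued and strictly increasing. It is
  proved by a double induction: two successors compare as their predecessors do.
\<close>

lemma nat_real_comparison:
  assumes "nat_real n r"
  shows "\<forall>m q. nat_real m q \<longrightarrow> n \<in> El m \<and> r \<prec> q \<or> n = m \<and> r = q \<or> m \<in> El n \<and> q \<prec> r"
  using assms
proof (induction n r rule: nat_real_induct)
  case definable show ?case by (intro definable_intros)
next
  case zero
  then show ?case using nat_real_comparison_zero by blast
next
  case (succ n r)
  have "succ n \<in> El m \<and> r [+] r1 \<prec> q \<or> succ n = m \<and> r [+] r1 = q \<or> m \<in> El (succ n) \<and> q \<prec> r [+] r1"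
    if "nat_real m q" for m q
    using that
  proof (induction m q rule: nat_real_induct)
    case definable show ?case by (intro definable_intros)
  next
    case zero
    then show ?case using nat_real_comparison_zero[OF nat_real_succ[OF succ(1)]] by blast
  next
    case (succ m q)
    have car: "n \<in> El omega" "r \<in> Reals" "m \<in> El omega" "q \<in> Reals"
      using nat_real_carrier succ(1) \<open>nat_real n r\<close> by auto
    have "n \<in> El m \<and> r \<prec> q \<or> n = m \<and> r = q \<or> m \<in> El n \<and> q \<prec> r"
      using succ(1) \<open>\<forall>m q. nat_real m q \<longrightarrow> n \<in> El m \<and> r \<prec> q \<or> n = m \<and> r = q \<or> m \<in> El n \<and> q \<prec> r\<close> by blast
    then show ?case
      using car succ_mem_succ[of n] succ_mem_succ[of m] plus_mono[of r q r1] plus_mono[of q r r1]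
      by (metis one_closed)
  qed
  then show ?case by blast
qed

text \<open>
  The Archimedean property: if the values had a supremum \<open>u\<close>, some value would exceed \<open>u - 1\<close> and the
  next one \<open>u\<close>.
\<close>

lemma nat_real_unbounded:
  assumes B: "B \<in> Reals" shows "\<exists>n r. nat_real n r \<and> B \<prec> r"
proof (rule ccontr)
  assume neg: "\<not> ?thesis"
  have "\<exists>A. El A = {r \<in> Reals. \<exists>n. nat_real n r}"
    by (rule separation) (intro definable_intros)
  then obtain A where A: "El A = {r \<in> Reals. \<exists>n. nat_real n r}" by blast
  have "r1 \<in> El A" using A nat_real_zero by auto
  then have "El A \<noteq> {}" by blast
  moreover have "\<forall>x\<in>El A. \<not> B \<prec> x" using neg A by blast
  ultimately obtain u where u: "u \<in> Reals" "\<forall>x\<in>El A. \<not> u \<prec> x"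
    "\<forall>v\<in>Reals. (\<forall>x\<in>El A. \<not> v \<prec> x) \<longrightarrow> \<not> v \<prec> u"
    using supremum_exists[of A B] B A by blast
  obtain d where d: "d \<in> Reals" "r1 [+] d = r0" using ex_uminus[of r1 r1] by auto
  have "u \<prec> u [+] r1" using u less_plus zero_less_one by simp
  then have "u [+] d \<prec> u" using less_plus_iff(1)[OF u(1) u(1) one_closed d] by simp
  then obtain r where r: "r \<in> El A" "u [+] d \<prec> r" using u d by blast
  then have "u \<prec> r [+] r1" using less_plus_iff(1)[OF u(1) _ one_closed d] A by simp
  moreover have "r [+] r1 \<in> El A" using r A nat_real_succ by auto
  ultimately show False using u by blast
qed

text \<open>
  The sequence \<open>1 / (n + 1)\<close>. Only three properties matter later: it is positive, bounded by \<open>1\<close>, and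
  for each \<open>a > 0\<close> all exceptional indices lie in one natural number \<open>N\<close>, a finite set.
\<close>

lemma null_sequence_exists:
  "\<exists>e. is_function mem e omega (Dom R) \<and> (\<forall>n\<in>El omega. r0 \<prec> ap e n \<and> \<not> r1 \<prec> ap e n) \<and>
     (\<forall>a\<in>Reals. r0 \<prec> a \<longrightarrow> (\<exists>N\<in>El omega. \<forall>n\<in>El omega. n \<notin> El N \<longrightarrow> ap e n \<prec> a))"
proof -
  let ?Q = "\<lambda>n y. \<exists>r. nat_real n r \<and> r [*] y = r1"
  have pos: "r0 \<prec> r" "r \<noteq> r0" if "nat_real n r" for n r
    using nat_real_comparison_zero[OF that] zero_less_one less_trans[of r0 r1 r]
      nat_real_carrier[OF that] less_irrefl by auto
  have inv: "\<exists>!y. y \<in> Reals \<and> ?Q n y" if n: "n \<in> El omega" for n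
  proof -
    obtain r where r: "nat_real n r" using nat_real_total n by blast
    have rR: "r \<in> Reals" using nat_real_carrier r by blast
    have uniq: "q = r" if "nat_real n q" for q
      using nat_real_comparison[OF r] that not_self by blast
    obtain y where y: "y \<in> Reals" "r [*] y = r1" using ex_inverse[OF rR rR] pos[OF r] by blast
    have "z = y" if z: "z \<in> Reals" "r [*] z = r1" for z
    proof -
      have "\<not> z \<prec> y" using times_mono[of z y r] pos[OF r] z y rR less_irrefl[of r1] times_comm by auto
      moreover have "\<not> y \<prec> z" using times_mono[of y z r] pos[OF r] z y rR less_irrefl[of r1] times_comm by auto
      ultimately show ?thesis using less_linear z y by blast
    qed
    then show ?thesis using r uniq y by blast
  qed
  define t where "t n = (THE y. y \<in> Reals \<and> ?Q n y)" for n
  have t: "t n \<in> Reals" "?Q n (t n)" if "n \<in> El omega" for n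
    using theI'[OF inv[OF that]] unfolding t_def by auto
  have "\<exists>e. is_function mem e omega (Dom R) \<and> (\<forall>n\<in>El omega. app mem e n = t n)"
  proof (rule function_exists[where Q = ?Q])
    show "definable (\<lambda>s. ?Q (s 0) (s (Suc 0)))" by (intro definable_intros)
  qed (use t inv in blast)+
  then obtain e where e: "is_function mem e omega (Dom R)" "\<forall>n\<in>El omega. ap e n = t n"
    using app_eq_ap by metis
  have "r0 \<prec> t n" if n: "n \<in> El omega" for n
  proof (rule ccontr)
    obtain r where r: "nat_real n r" "r [*] t n = r1" using t n by blast
    have rR: "r \<in> Reals" using nat_real_carrier r by blast
    assume "\<not> r0 \<prec> t n"
    then have "t n = r0 \<or> t n \<prec> r0" using less_linear t(1) n zero_closed by blast
    moreover have "t n \<noteq> r0" using r rR one_neq_zero by auto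
    moreover have "\<not> t n \<prec> r0"
      using times_mono[of "t n" r0 r] pos[OF r(1)] rR t(1)[OF n] r times_comm zero_less_one less_asym by auto
    ultimately show False by blast
  qed
  moreover have "\<not> r1 \<prec> t n" if n: "n \<in> El omega" for n
  proof
    obtain r where r: "nat_real n r" "r [*] t n = r1" using t n by blast
    have rR: "r \<in> Reals" using nat_real_carrier r by blast
    assume "r1 \<prec> t n"
    then have "r1 [*] r \<prec> t n [*] r"
      using times_mono[of r1 "t n" r] pos(1)[OF r(1)] rR t(1)[OF n] by auto
    then have "r \<prec> r1" using r rR t(1)[OF n] times_comm by auto
    then show False
      using nat_real_comparison_zero[OF r(1)] less_irrefl[of r1] less_asym[of r r1] rR by auto
  qed
  moreover have "\<exists>N\<in>El omega. \<forall>n\<in>El omega. n \<notin> El N \<longrightarrow> t n \<prec> a"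
    if a: "a \<in> Reals" "r0 \<prec> a" for a
  proof -
    obtain B where B: "B \<in> Reals" "a [*] B = r1"
      using ex_inverse[of a] a less_irrefl[of a] by blast
    obtain N q where N: "nat_real N q" "B \<prec> q" using nat_real_unbounded B by blast
    have "t n \<prec> a" if n: "n \<in> El omega" "n \<notin> El N" for n
    proof -
      obtain r where r: "nat_real n r" "r [*] t n = r1" using t n by blast
      have car: "r \<in> Reals" "q \<in> Reals" "t n \<in> Reals" using nat_real_carrier r N t n by auto
      have "B \<prec> r"
        using nat_real_comparison[OF N(1)] r(1) n(2) N(2) less_trans[of B q r] car B by blast
      then have 1: "r1 \<prec> r [*] a"
        using times_mono[of B r a] a B car times_comm by auto
      show ?thesis
      proof (rule ccontr)
        assume "\<not> t n \<prec> a"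
        then have "a = t n \<or> a \<prec> t n" using less_linear car a by blast
        moreover have "a \<noteq> t n" using 1 r less_irrefl[OF one_closed] by auto
        moreover have "\<not> a \<prec> t n"
        proof
          assume "a \<prec> t n"
          then have "a [*] r \<prec> t n [*] r" using times_mono pos(1)[OF r(1)] car a by blast
          then have "r [*] a \<prec> r1" using r(2) times_comm car a by metis
          then show False using 1 less_asym[of r1 "r [*] a"] car a by auto
        qed
        ultimately show False by blast
      qed
    qed
    then show ?thesis using N nat_real_carrier by blast
  qed
  ultimately show ?thesis using e by force
qed

lemma dense:
  assumes "a \<prec> b" "a \<in> Reals" "b \<in> Reals"
  shows "\<exists>c\<in>Reals. a \<prec> c \<and> c \<prec> b"
proof -
  obtain e where e: "is_function mem e omega (Dom R)" "\<forall>n\<in>El omega. r0 \<prec> ap e n \<and> \<not> r1 \<prec> ap e n"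
     "\<forall>a\<in>Reals. r0 \<prec> a \<longrightarrow> (\<exists>N\<in>El omega. \<forall>n\<in>El omega. n \<notin> El N \<longrightarrow> ap e n \<prec> a)"
    using null_sequence_exists by blast
  obtain d where d: "d \<in> Reals" "a [+] d = r0" using ex_uminus[of a a] assms by auto
  have "r0 \<prec> b [+] d" using plus_mono[OF assms(1), of d] d assms by simp
  \<comment> \<open>The index \<open>N\<close> itself is not exceptional, because \<open>N \<notin> N\<close>.\<close>
  then obtain N where N: "N \<in> El omega" "ap e N \<prec> b [+] d"
    using e(3) not_self d assms by (metis plus_closed)
  have eN: "ap e N \<in> Reals" using e N ap_closed by blast
  have "a \<prec> a [+] ap e N" using less_plus e N eN assms by blast
  moreover have "ap e N [+] a \<prec> b"
    using less_plus_iff(2)[of b "ap e N" a d] N d eN assms by blast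
  ultimately show ?thesis using plus_comm[of a "ap e N"] eN assms by (metis plus_closed)
qed

end

locale ZF_space = ZF_real mem R for mem :: "'m \<Rightarrow> 'm \<Rightarrow> bool" and R :: "'m ordered_field_structure" +
  fixes X \<tau> :: 'm
  assumes space: "topological_space_on mem X \<tau>"
begin

section \<open>Open sets and continuous functions\<close>

lemma
  shows open_subset: "U \<in> El \<tau> \<Longrightarrow> El U \<subseteq> El X"
    and open_space: "X \<in> El \<tau>"
    and open_Int: "U \<in> El \<tau> \<Longrightarrow> V \<in> El \<tau> \<Longrightarrow> \<exists>W\<in>El \<tau>. El W = El U \<inter> El V"
    and open_Union: "El S \<subseteq> El \<tau> \<Longrightarrow> \<exists>W\<in>El \<tau>. El W = (\<Union>U\<in>El S. El U)"
  using space unfolding topological_space_on_def by simp_all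

text \<open>
  Openness of the set of points with a given property. In this form openness is itself a definable
  condition on the parameters of the property.
\<close>

abbreviation open_pred :: "('m \<Rightarrow> bool) \<Rightarrow> bool" where
  "open_pred P \<equiv> \<exists>U\<in>El \<tau>. \<forall>y. y \<in> El U \<longleftrightarrow> y \<in> El X \<and> P y"

lemma open_pred_cong: "open_pred P \<Longrightarrow> (\<And>y. y \<in> El X \<Longrightarrow> P y \<longleftrightarrow> Q y) \<Longrightarrow> open_pred Q"
  by metis

lemma open_pred_conj: "open_pred P \<Longrightarrow> open_pred Q \<Longrightarrow> open_pred (\<lambda>y. P y \<and> Q y)"
proof -
  assume "open_pred P" "open_pred Q"
  then obtain U V where "U \<in> El \<tau>" "V \<in> El \<tau>"
    and UV: "\<And>y. y \<in> El U \<longleftrightarrow> y \<in> El X \<and> P y" "\<And>y. y \<in> El V \<longleftrightarrow> y \<in> El X \<and> Q y"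
    by blast
  then obtain W where W: "W \<in> El \<tau>" "El W = El U \<inter> El V"
    using open_Int by blast
  show ?thesis by (rule bexI[OF _ W(1)]) (auto simp: W UV)
qed

text \<open>
  A set that contains an open neighbourhood of each of its points is the union of all open sets
  inside it, a family of the model. No neighbourhoods have to be chosen, so this works without
  the axiom of choice.
\<close>

lemma open_pred_local:
  assumes P: "definable (\<lambda>s. P (s 0))"
    and loc: "\<And>y. y \<in> El X \<Longrightarrow> P y \<Longrightarrow> \<exists>Q. open_pred Q \<and> Q y \<and> (\<forall>z\<in>El X. Q z \<longrightarrow> P z)"
  shows "open_pred P"
proof -
  have "\<exists>S. El S = {U \<in> El \<tau>. \<forall>z\<in>El U. P z}"
    by (rule separation) (intro definable_intros P[THEN definable_subst1])
  then obtain S where S: "El S = {U \<in> El \<tau>. \<forall>z\<in>El U. P z}" by blast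
  then obtain W where W: "W \<in> El \<tau>" "El W = (\<Union>U\<in>El S. El U)"
    using open_Union[of S] by blast
  have "y \<in> El W \<longleftrightarrow> y \<in> El X \<and> P y" for y
  proof
    assume "y \<in> El W"
    then show "y \<in> El X \<and> P y"
      using W S open_subset by blast
  next
    assume y: "y \<in> El X \<and> P y"
    then have "\<exists>Q. open_pred Q \<and> Q y \<and> (\<forall>z\<in>El X. Q z \<longrightarrow> P z)" using loc by simp
    then obtain Q U where U: "U \<in> El \<tau>" "\<forall>z. z \<in> El U \<longleftrightarrow> z \<in> El X \<and> Q z"
      and Q: "Q y" "\<forall>z\<in>El X. Q z \<longrightarrow> P z"
      by (elim exE conjE bexE) (rule that)
    have "U \<in> El S" "y \<in> El U" using S U Q y by simp_all
    then show "y \<in> El W" unfolding W by blast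
  qed
  then show ?thesis using W(1) by blast
qed

lemma open_pred_const: "open_pred (\<lambda>y. b)"
proof (cases b)
  case True
  show ?thesis using True open_space by (intro bexI[of _ X]) auto
next
  case False
  show ?thesis by (rule open_pred_local) (intro definable_intros, use False in blast)
qed

lemma open_pred_disj:
  assumes "definable (\<lambda>s. P (s 0))" "definable (\<lambda>s. Q (s 0))" "open_pred P" "open_pred Q"
  shows "open_pred (\<lambda>y. P y \<or> Q y)"
  by (rule open_pred_local) (intro definable_intros assms, use assms(3,4) in blast)

text \<open>
  Finiteness is that of the model, so the intersection is formed by induction on an initial segment of
  the enumerating natural number.
\<close>

lemma open_pred_finite_ball:
  assumes fin: "finite_in_model mem a"
    and P: "definable (\<lambda>s. P (s 0) (s (Suc 0)))"
    and open_pred: "\<And>g. g \<in> El a \<Longrightarrow> open_pred (P g)"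
  shows "open_pred (\<lambda>z. \<forall>g\<in>El a. P g z)"
proof -
  obtain k f where k: "k \<in> El omega" and f: "is_function mem f k a"
    and surj: "\<forall>y\<in>El a. \<exists>x\<in>El k. ap f x = y"
    using fin app_eq_ap unfolding finite_in_model_def is_omega_iff by metis
  have "open_pred (\<lambda>z. \<forall>i\<in>El j. i \<in> El k \<longrightarrow> P (ap f i) z)" if "j \<in> El omega" for j
    using that
  proof (induction j rule: omega_induct)
    case definable
    show ?case by (intro definable_intros P[THEN definable_subst2])
  next
    case zero
    show ?case using open_pred_const[of True] by simp
  next
    case (succ j)
    have "open_pred (\<lambda>z. j \<in> El k \<longrightarrow> P (ap f j) z)"
      using open_pred[of "ap f j"] ap_closed[OF f] open_pred_const[of True] by (cases "j \<in> El k") simp_all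
    from open_pred_conj[OF this succ(2)] show ?case by simp
  qed
  from this[OF k] show ?thesis
    by (rule open_pred_cong) (use surj ap_closed[OF f] in metis)
qed

text \<open>
  The open rays form a subbase of the real line. The ray conditions are easy to check for
  constructed functions and make continuity a definable property.
\<close>

lemma continuous_real_iff:
  "continuous_real mem R X \<tau> f \<longleftrightarrow> is_function mem f X (Dom R) \<and>
     (\<forall>a\<in>Reals. open_pred (\<lambda>y. a \<prec> ap f y) \<and> open_pred (\<lambda>y. ap f y \<prec> a))"
proof (cases "is_function mem f X (Dom R)")
  case f: True
  show ?thesis
  proof safe
    assume cont: "continuous_real mem R X \<tau> f"
    have pre: "open_pred (\<lambda>y. ap f y \<in> El V)" if "real_open mem R V" for V
      using cont that app_eq_ap[OF f] unfolding continuous_real_def by (metis (no_types, lifting) mem_Collect_eq)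
    fix a assume a: "a \<in> Reals"
    have "\<exists>V. El V = {t \<in> Reals. a \<prec> t}" "\<exists>V. El V = {t \<in> Reals. t \<prec> a}"
      by (rule separation, intro definable_intros)+
    then obtain V W where V: "El V = {t \<in> Reals. a \<prec> t}" and W: "El W = {t \<in> Reals. t \<prec> a}" by blast
    have "real_open mem R V"
      unfolding real_open_def V less_real_def using a ex_greater by blast
    from pre[OF this] show "open_pred (\<lambda>y. a \<prec> ap f y)"
      by (rule open_pred_cong) (simp add: V ap_closed[OF f])
    have "real_open mem R W"
      unfolding real_open_def W less_real_def using a ex_less by blast
    from pre[OF this] show "open_pred (\<lambda>y. ap f y \<prec> a)"
      by (rule open_pred_cong) (simp add: W ap_closed[OF f])
  next
    assume rays: "\<forall>a\<in>Reals. open_pred (\<lambda>y. a \<prec> ap f y) \<and> open_pred (\<lambda>y. ap f y \<prec> a)"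
    have "open_pred (\<lambda>y. ap f y \<in> El V)" if V: "real_open mem R V" for V
    proof (rule open_pred_local)
      show "definable (\<lambda>s. ap f (s 0) \<in> El V)" by (intro definable_intros)
      fix y assume y: "y \<in> El X" "ap f y \<in> El V"
      then obtain a b where ab: "a \<in> Reals" "b \<in> Reals" "a \<prec> ap f y" "ap f y \<prec> b"
        "{t \<in> Reals. a \<prec> t \<and> t \<prec> b} \<subseteq> El V"
        using V unfolding real_open_def less_real_def by blast
      have "open_pred (\<lambda>z. a \<prec> ap f z \<and> ap f z \<prec> b)"
        by (rule open_pred_conj) (use rays ab in blast)+
      moreover have "\<forall>z\<in>El X. a \<prec> ap f z \<and> ap f z \<prec> b \<longrightarrow> ap f z \<in> El V"
        using ab ap_closed[OF f] by blast
      ultimately show "\<exists>Q. open_pred Q \<and> Q y \<and> (\<forall>z\<in>El X. Q z \<longrightarrow> ap f z \<in> El V)"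
        using ab by (intro exI[of _ "\<lambda>z. a \<prec> ap f z \<and> ap f z \<prec> b"]) blast
    qed
    then show "continuous_real mem R X \<tau> f"
      unfolding continuous_real_def set_eq_iff mem_Collect_eq by (simp add: f app_eq_ap[OF f] cong: conj_cong)
  qed (rule f)
qed (simp add: continuous_real_def)

abbreviation continuous :: "'m \<Rightarrow> bool" where
  "continuous \<equiv> continuous_real mem R X \<tau>"
abbreviation zeroset :: "'m \<Rightarrow> bool" where
  "zeroset \<equiv> zero_set mem R X \<tau>"

lemma continuous_closed: "continuous f \<Longrightarrow> x \<in> El X \<Longrightarrow> ap f x \<in> Reals"
  unfolding continuous_real_def using ap_closed by blast

lemma app_continuous: "continuous f \<Longrightarrow> x \<in> El X \<Longrightarrow> app mem f x = ap f x"
  unfolding continuous_real_def using app_eq_ap by blast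

lemma continuous_open_pred:
  assumes "continuous f" "a \<in> Reals"
  shows "open_pred (\<lambda>y. a \<prec> ap f y)" "open_pred (\<lambda>y. ap f y \<prec> a)"
  using assms unfolding continuous_real_iff by blast+

lemma continuous_definable [THEN definable_subst1, definable_intros]:
  "definable (\<lambda>s. continuous (s 0))"
  unfolding continuous_real_iff by (intro definable_intros)

lemma zero_set_iff:
  "zeroset Z \<longleftrightarrow> (\<exists>f. continuous f \<and> (\<forall>x. x \<in> El Z \<longleftrightarrow> x \<in> El X \<and> ap f x = r0))"
  unfolding zero_set_def set_eq_iff mem_Collect_eq
  by (simp add: app_continuous cong: conj_cong)

lemma zero_set_definable [THEN definable_subst1, definable_intros]:
  "definable (\<lambda>s. zeroset (s 0))"
  unfolding zero_set_iff by (intro definable_intros)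

lemma zero_set_exists: "continuous f \<Longrightarrow> \<exists>Z. zeroset Z \<and> (\<forall>x. x \<in> El Z \<longleftrightarrow> x \<in> El X \<and> ap f x = r0)"
proof -
  assume f: "continuous f"
  have "\<exists>Z. El Z = {x \<in> El X. ap f x = r0}" by (rule separation) (intro definable_intros)
  then show ?thesis using f unfolding zero_set_iff by blast
qed

lemma continuous_exists:
  assumes "definable (\<lambda>s. Q (s 0) (s (Suc 0)))"
    and "\<And>x. x \<in> El X \<Longrightarrow> t x \<in> Reals"
    and "\<And>x y. x \<in> El X \<Longrightarrow> y \<in> Reals \<Longrightarrow> Q x y \<longleftrightarrow> y = t x"
    and "\<And>a. a \<in> Reals \<Longrightarrow> open_pred (\<lambda>x. a \<prec> t x)" "\<And>a. a \<in> Reals \<Longrightarrow> open_pred (\<lambda>x. t x \<prec> a)"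
  shows "\<exists>f. continuous f \<and> (\<forall>x\<in>El X. ap f x = t x)"
proof -
  have "\<exists>f. is_function mem f X (Dom R) \<and> (\<forall>x\<in>El X. app mem f x = t x)"
    by (rule function_exists[OF assms(1-3)])
  then obtain f where f: "is_function mem f X (Dom R)" "\<forall>x\<in>El X. ap f x = t x"
    by (auto simp: app_eq_ap)
  moreover have "continuous f"
    unfolding continuous_real_iff
  proof (intro conjI ballI f(1))
    fix a assume a: "a \<in> Reals"
    show "open_pred (\<lambda>x. a \<prec> ap f x)" by (rule open_pred_cong[OF assms(4)[OF a]]) (simp add: f)
    show "open_pred (\<lambda>x. ap f x \<prec> a)" by (rule open_pred_cong[OF assms(5)[OF a]]) (simp add: f)
  qed
  ultimately show ?thesis by blast
qed

lemma continuous_translate: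
  assumes g: "continuous g" and d: "d \<in> Reals"
  shows "\<exists>h. continuous h \<and> (\<forall>x\<in>El X. ap h x = ap g x [+] d)"
proof (rule continuous_exists)
  show "definable (\<lambda>s. s (Suc 0) = ap g (s 0) [+] d)" by (intro definable_intros)
  obtain c where c: "c \<in> Reals" "d [+] c = r0" using ex_uminus[OF d d] by blast
  fix a assume a: "a \<in> Reals"
  have ac: "a [+] c \<in> Reals" using a c by simp
  show "open_pred (\<lambda>x. a \<prec> ap g x [+] d)"
    by (rule open_pred_cong[OF continuous_open_pred(1)[OF g ac]])
      (use less_plus_iff(1)[OF a _ d c] continuous_closed[OF g] in blast)
  show "open_pred (\<lambda>x. ap g x [+] d \<prec> a)"
    by (rule open_pred_cong[OF continuous_open_pred(2)[OF g ac]])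
      (use less_plus_iff(2)[OF a _ d c] continuous_closed[OF g] in blast)
qed (use continuous_closed[OF g] d in auto)

lemma continuous_max:
  assumes f: "continuous f" and g: "continuous g"
  shows "\<exists>h. continuous h \<and> (\<forall>x\<in>El X. ap h x = (if ap f x \<prec> ap g x then ap g x else ap f x))"
proof (rule continuous_exists)
  note car = continuous_closed[OF f] continuous_closed[OF g]
  show "definable (\<lambda>s. (ap f (s 0) \<prec> ap g (s 0) \<and> s (Suc 0) = ap g (s 0)) \<or>
      (\<not> ap f (s 0) \<prec> ap g (s 0) \<and> s (Suc 0) = ap f (s 0)))" by (intro definable_intros)
  fix a assume a: "a \<in> Reals"
  have "open_pred (\<lambda>x. a \<prec> ap f x \<or> a \<prec> ap g x)"
    by (intro open_pred_disj definable_intros continuous_open_pred assms a)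
  then show "open_pred (\<lambda>x. a \<prec> (if ap f x \<prec> ap g x then ap g x else ap f x))"
  proof (rule open_pred_cong)
    fix x assume x: "x \<in> El X"
    show "a \<prec> ap f x \<or> a \<prec> ap g x \<longleftrightarrow> a \<prec> (if ap f x \<prec> ap g x then ap g x else ap f x)"
      using less_trans[of a "ap f x" "ap g x"] less_le_trans[of a "ap g x" "ap f x"] a car[OF x] by auto
  qed
  have "open_pred (\<lambda>x. ap f x \<prec> a \<and> ap g x \<prec> a)"
    by (intro open_pred_conj continuous_open_pred assms a)
  then show "open_pred (\<lambda>x. (if ap f x \<prec> ap g x then ap g x else ap f x) \<prec> a)"
  proof (rule open_pred_cong)
    fix x assume x: "x \<in> El X"
    show "ap f x \<prec> a \<and> ap g x \<prec> a \<longleftrightarrow> (if ap f x \<prec> ap g x then ap g x else ap f x) \<prec> a"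
      using less_trans[of "ap f x" "ap g x" a] le_less_trans[of "ap f x" "ap g x" a] a car[OF x] by auto
  qed
qed (auto simp: continuous_closed assms)

lemma continuous_uminus:
  assumes f: "continuous f"
  shows "\<exists>h. continuous h \<and> (\<forall>x\<in>El X. ap f x [+] ap h x = r0)"
proof -
  obtain neg where neg: "\<And>x. x \<in> Reals \<Longrightarrow> neg x \<in> Reals \<and> x [+] neg x = r0"
    using ex_uminus by metis
  have neg_eq: "y = neg x" if "x \<in> Reals" "y \<in> Reals" "x [+] y = r0" for x y
    using plus_cancel(1)[OF that(2,2) that(1), of "neg x"] that neg[OF that(1)] by (simp add: plus_comm)
  note car = continuous_closed[OF f]
  have "\<exists>h. continuous h \<and> (\<forall>x\<in>El X. ap h x = neg (ap f x))"
  proof (rule continuous_exists)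
    show "definable (\<lambda>s. ap f (s 0) [+] s (Suc 0) = r0)" by (intro definable_intros)
    show "ap f x [+] y = r0 \<longleftrightarrow> y = neg (ap f x)" if "x \<in> El X" "y \<in> Reals" for x y
      using neg_eq neg car that by blast
    show "neg (ap f x) \<in> Reals" if "x \<in> El X" for x using neg car that by blast
    fix a assume a: "a \<in> Reals"
    have *: "t \<prec> neg u \<longleftrightarrow> u \<prec> neg t" "neg u \<prec> t \<longleftrightarrow> neg t \<prec> u" if "t \<in> Reals" "u \<in> Reals" for t u
    proof -
      note nt = neg[OF that(1), THEN conjunct1] and nu = neg[OF that(2), THEN conjunct1]
      have eqs: "neg u [+] u = r0" "neg t [+] t = r0" using neg plus_comm that nt nu by auto
      show "t \<prec> neg u \<longleftrightarrow> u \<prec> neg t"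
        using less_plus_iff(1)[of t r0 "neg u" u] less_plus_iff(1)[of u r0 "neg t" t]
          eqs that nt nu plus_comm[of t u] by simp
      show "neg u \<prec> t \<longleftrightarrow> neg t \<prec> u"
        using less_plus_iff(2)[of t r0 "neg u" u] less_plus_iff(2)[of u r0 "neg t" t]
          eqs that nt nu plus_comm[of t u] by simp
    qed
    have na: "neg a \<in> Reals" using neg a by blast
    show "open_pred (\<lambda>x. a \<prec> neg (ap f x))"
      by (rule open_pred_cong[OF continuous_open_pred(2)[OF f na]]) (use * a car in blast)
    show "open_pred (\<lambda>x. neg (ap f x) \<prec> a)"
      by (rule open_pred_cong[OF continuous_open_pred(1)[OF f na]]) (use * a car in blast)
  qed
  then show ?thesis using neg car by metis
qed

text \<open>
  The function \<open>max f (- f)\<close> has the same zeros as \<open>f\<close>.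
\<close>

lemma zero_set_nonneg:
  assumes "zeroset Z"
  shows "\<exists>h. continuous h \<and> (\<forall>x\<in>El X. \<not> ap h x \<prec> r0) \<and>
     (\<forall>x. x \<in> El Z \<longleftrightarrow> x \<in> El X \<and> ap h x = r0)"
proof -
  obtain f where f: "continuous f" and Z: "\<And>x. x \<in> El Z \<longleftrightarrow> x \<in> El X \<and> ap f x = r0"
    using assms unfolding zero_set_iff by blast
  obtain g where g: "continuous g" "\<And>x. x \<in> El X \<Longrightarrow> ap f x [+] ap g x = r0"
    using continuous_uminus[OF f] by blast
  obtain h where h: "continuous h"
    "\<And>x. x \<in> El X \<Longrightarrow> ap h x = (if ap f x \<prec> ap g x then ap g x else ap f x)"
    using continuous_max[OF f g(1)] by blast
  have "\<not> ap h x \<prec> r0 \<and> (ap h x = r0 \<longleftrightarrow> ap f x = r0)" if x: "x \<in> El X" for x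
  proof -
    have car: "ap f x \<in> Reals" "ap g x \<in> Reals" using continuous_closed f g(1) x by auto
    have 1: "ap f x \<prec> r0 \<Longrightarrow> r0 \<prec> ap g x" "r0 \<prec> ap f x \<Longrightarrow> ap g x \<prec> r0"
      using plus_mono[of "ap f x" r0 "ap g x"] plus_mono[of r0 "ap f x" "ap g x"] car g(2)[OF x] by auto
    have 2: "ap f x = r0 \<Longrightarrow> ap g x = r0" using g(2)[OF x] car by auto
    consider "ap f x \<prec> r0" | "ap f x = r0" | "r0 \<prec> ap f x" using less_linear[OF car(1) zero_closed] by blast
    then show ?thesis
    proof cases
      case a: 1
      then have "ap f x \<prec> ap g x" using 1 less_trans[of "ap f x" r0 "ap g x"] car by simp
      then have "ap h x = ap g x" using h(2)[OF x] by simp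
      then show ?thesis
        using a 1(1)[OF a] less_irrefl[of r0] less_asym[of r0 "ap g x"] car by auto
    next
      case 2
      then show ?thesis using \<open>ap f x = r0 \<Longrightarrow> ap g x = r0\<close> h(2)[OF x] less_irrefl[of r0] by simp
    next
      case a: 3
      then have "\<not> ap f x \<prec> ap g x"
        using 1(2)[OF a] less_trans[of "ap g x" r0 "ap f x"] less_asym car by auto
      then have "ap h x = ap f x" using h(2)[OF x] by simp
      then show ?thesis
        using a less_irrefl[of r0] less_asym[of r0 "ap f x"] car by auto
    qed
  qed
  then show ?thesis using h(1) Z by blast
qed

lemma zero_set_Int:
  assumes "zeroset Y" "zeroset Z"
  shows "\<exists>W. zeroset W \<and> El W = El Y \<inter> El Z"
proof -
  obtain f where f: "continuous f" "\<forall>x\<in>El X. \<not> ap f x \<prec> r0" "\<forall>x. x \<in> El Y \<longleftrightarrow> x \<in> El X \<and> ap f x = r0"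
    using zero_set_nonneg[OF assms(1)] by blast
  obtain g where g: "continuous g" "\<forall>x\<in>El X. \<not> ap g x \<prec> r0" "\<forall>x. x \<in> El Z \<longleftrightarrow> x \<in> El X \<and> ap g x = r0"
    using zero_set_nonneg[OF assms(2)] by blast
  obtain h where h: "continuous h"
    "\<And>x. x \<in> El X \<Longrightarrow> ap h x = (if ap f x \<prec> ap g x then ap g x else ap f x)"
    using continuous_max[OF f(1) g(1)] by blast
  obtain W where W: "zeroset W" "\<And>x. x \<in> El W \<longleftrightarrow> x \<in> El X \<and> ap h x = r0"
    using zero_set_exists[OF h(1)] by blast
  have "ap h x = r0 \<longleftrightarrow> ap f x = r0 \<and> ap g x = r0" if x: "x \<in> El X" for x
  proof -
    have car: "ap f x \<in> Reals" "ap g x \<in> Reals" using continuous_closed f(1) g(1) x by auto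
    show ?thesis
      using f(2) g(2) h(2)[OF x] x car less_linear[of "ap f x" "ap g x"] less_irrefl by auto
  qed
  then have "El W = El Y \<inter> El Z" using W f g by blast
  then show ?thesis using W by blast
qed

lemma zero_set_space: "zeroset X"
proof -
  have "\<exists>f. continuous f \<and> (\<forall>x\<in>El X. ap f x = r0)"
    by (rule continuous_exists[where Q = "\<lambda>x y. y = r0"])
      (intro definable_intros open_pred_const, auto intro: open_pred_const)
  then show ?thesis unfolding zero_set_iff by blast
qed

text \<open>
  A cozero-set \<open>{g \<noteq> 0}\<close> around \<open>x\<close> inside \<open>U\<close> contains the zero-set of \<open>g - g x\<close>, which
  contains \<open>x\<close>.
\<close>

lemma zero_set_in_open:
  assumes cr: "completely_regular mem R X \<tau>" and U: "U \<in> El \<tau>" "x \<in> El U"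
  shows "\<exists>Z. zeroset Z \<and> x \<in> El Z \<and> El Z \<subseteq> El U"
proof -
  obtain S where S: "El S \<subseteq> {U. \<exists>Z. zeroset Z \<and> El U = El X - El Z}" "El U = (\<Union>V\<in>El S. El V)"
    using cr U unfolding completely_regular_def is_base_def by blast
  have "x \<in> (\<Union>V\<in>El S. El V)" using U(2) S(2) by simp
  then obtain V where V: "V \<in> El S" "x \<in> El V" by blast
  then have "El V \<subseteq> El U" using S(2) by auto
  moreover obtain Y where "zeroset Y" "El V = El X - El Y"
    using S(1) V(1) by (auto dest: subsetD)
  ultimately have Y: "zeroset Y" "x \<in> El X" "x \<notin> El Y" "El X - El Y \<subseteq> El U"
    using V(2) by simp_all
  then obtain g where g: "continuous g" "\<And>y. y \<in> El Y \<longleftrightarrow> y \<in> El X \<and> ap g y = r0"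
    unfolding zero_set_iff by blast
  have gx: "ap g x \<in> Reals" "ap g x \<noteq> r0" using g continuous_closed Y by auto
  obtain d where d: "d \<in> Reals" "ap g x [+] d = r0" using ex_uminus gx by blast
  obtain h where h: "continuous h" "\<And>y. y \<in> El X \<Longrightarrow> ap h y = ap g y [+] d"
    using continuous_translate[OF g(1) d(1)] by blast
  obtain Z where Z: "zeroset Z" "\<And>y. y \<in> El Z \<longleftrightarrow> y \<in> El X \<and> ap h y = r0"
    using zero_set_exists[OF h(1)] by blast
  have "x \<in> El Z" using Z h d Y by simp
  moreover have "El Z \<subseteq> El U"
  proof
    fix y assume y: "y \<in> El Z"
    then have "y \<in> El X" "ap g y [+] d = r0" using Z h by auto
    moreover have "r0 [+] d \<noteq> r0" using d gx by auto
    ultimately show "y \<in> El U" using Y(4) g(2) by auto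
  qed
  ultimately show ?thesis using Z(1) by blast
qed

section \<open>Countable intersections of zero-sets\<close>

text \<open>
  \<open>u\<close> is an upper bound of all \<open>min (g y) (e n)\<close> with \<open>g \<in> G n\<close>, expressed without the minimum.
\<close>

definition capped_bound :: "'m \<Rightarrow> 'm \<Rightarrow> 'm \<Rightarrow> 'm \<Rightarrow> bool" where
  "capped_bound G e y u \<longleftrightarrow>
     (\<forall>n\<in>El omega. \<forall>g\<in>El (ap G n). \<not> (u \<prec> ap g y \<and> u \<prec> ap e n))"

text \<open>
  The value of \<open>h\<close> at \<open>y\<close> is the least non-negative bound. It exceeds \<open>a \<ge> 0\<close> iff some \<open>g\<close> with
  \<open>e n > a\<close> does, which is open for any family. It is below \<open>a\<close> iff for some positive \<open>b < a\<close>
  all \<open>g \<in> G n\<close> with \<open>e n \<ge> b\<close> are below \<open>b\<close>; here the null sequence and the finiteness of the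
  \<open>G n\<close> leave a finite intersection. The intermediate \<open>b\<close> replaces the maximum of the finitely
  many values.
\<close>

lemma capped_supremum_continuous:
  assumes G: "is_function mem G omega c"
    and fin: "\<And>n. n \<in> El omega \<Longrightarrow> finite_in_model mem (ap G n)"
    and cont: "\<And>n g. n \<in> El omega \<Longrightarrow> g \<in> El (ap G n) \<Longrightarrow> continuous g"
    and e: "is_function mem e omega (Dom R)"
    and e1: "\<And>n. n \<in> El omega \<Longrightarrow> \<not> r1 \<prec> ap e n"
    and e_null: "\<And>a. a \<in> Reals \<Longrightarrow> r0 \<prec> a \<Longrightarrow>
      \<exists>N\<in>El omega. \<forall>n\<in>El omega. n \<notin> El N \<longrightarrow> ap e n \<prec> a"
  shows "\<exists>h. continuous h \<and> (\<forall>y\<in>El X. \<not> ap h y \<prec> r0 \<and> capped_bound G e y (ap h y) \<and>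
     (\<forall>v\<in>Reals. \<not> v \<prec> r0 \<longrightarrow> capped_bound G e y v \<longrightarrow> \<not> v \<prec> ap h y))"
proof -
  have eR: "ap e n \<in> Reals" if "n \<in> El omega" for n using ap_closed[OF e that] .
  have gR: "ap g y \<in> Reals" if "n \<in> El omega" "g \<in> El (ap G n)" "y \<in> El X" for n g y
    using continuous_closed cont that by blast
  have capped_bound_definable: "definable (\<lambda>s. capped_bound G e (a s) (b s))" if "definable_term a" "definable_term b" for a b
    using that unfolding capped_bound_def by (intro definable_intros definable_term_shift)
  let ?Q = "\<lambda>y u. \<not> u \<prec> r0 \<and> capped_bound G e y u \<and> (\<forall>v\<in>Reals. \<not> v \<prec> r0 \<longrightarrow> capped_bound G e y v \<longrightarrow> \<not> v \<prec> u)"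
  have ex: "\<exists>u\<in>Reals. ?Q y u" if y: "y \<in> El X" for y
  proof -
    \<comment> \<open>Completeness provides suprema, so the least bound is found as the supremum of 0 and of all reals below some \<open>min (g y) (e n)\<close>.\<close>
    have "\<exists>A. El A = {r \<in> Reals. r = r0 \<or> (\<exists>n\<in>El omega. \<exists>g\<in>El (ap G n).
        \<not> ap g y \<prec> r \<and> \<not> ap e n \<prec> r)}"
      by (rule separation) (intro definable_intros)
    then obtain A where A: "El A = {r \<in> Reals. r = r0 \<or> (\<exists>n\<in>El omega. \<exists>g\<in>El (ap G n).
        \<not> ap g y \<prec> r \<and> \<not> ap e n \<prec> r)}" by blast
    have "r0 \<in> El A" unfolding A by simp
    then have ne: "El A \<noteq> {}" by blast
    have sub: "El A \<subseteq> Reals" unfolding A by blast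
    have below: "\<not> v \<prec> r" if r: "r \<in> El A" and v: "v \<in> Reals" "\<not> v \<prec> r0" "capped_bound G e y v" for r v
    proof
      assume vr: "v \<prec> r"
      have rR: "r \<in> Reals" using r sub by blast
      have "r \<noteq> r0" using vr v by blast
      then obtain n g where n: "n \<in> El omega" "g \<in> El (ap G n)" "\<not> ap g y \<prec> r" "\<not> ap e n \<prec> r"
        using r unfolding A by blast
      then have "v \<prec> ap g y" "v \<prec> ap e n"
        using less_le_trans[OF vr] v(1) rR eR gR y by blast+
      then show False using v(3) n unfolding capped_bound_def by blast
    qed
    have "capped_bound G e y r1" "\<not> r1 \<prec> r0"
      using e1 zero_less_one less_asym[of r0 r1] unfolding capped_bound_def by auto
    then have "\<forall>x\<in>El A. \<not> r1 \<prec> x" using below by simp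
    then obtain u where u: "u \<in> Reals" "\<forall>x\<in>El A. \<not> u \<prec> x"
      "\<forall>v\<in>Reals. (\<forall>x\<in>El A. \<not> v \<prec> x) \<longrightarrow> \<not> v \<prec> u"
      using supremum_exists[OF sub ne one_closed] by blast
    have "capped_bound G e y u"
      unfolding capped_bound_def
    proof (intro ballI notI)
      fix n g assume n: "n \<in> El omega" "g \<in> El (ap G n)" and lt: "u \<prec> ap g y \<and> u \<prec> ap e n"
      note car = eR[OF n(1)] gR[OF n y]
      have "ap g y \<in> El A" if "\<not> ap e n \<prec> ap g y"
        unfolding A using that n car less_irrefl by blast
      moreover have "ap e n \<in> El A" if "\<not> ap g y \<prec> ap e n"
        unfolding A using that n car less_irrefl by blast
      moreover have "\<not> ap e n \<prec> ap g y \<or> \<not> ap g y \<prec> ap e n"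
        using less_asym car by blast
      ultimately show False using u(2) lt by blast
    qed
    moreover have "\<not> u \<prec> r0" using u(2) \<open>r0 \<in> El A\<close> by blast
    ultimately show ?thesis using u below by blast
  qed
  then obtain t where t: "\<And>y. y \<in> El X \<Longrightarrow> t y \<in> Reals \<and> ?Q y (t y)" by metis
  have uniq: "?Q y u \<longleftrightarrow> u = t y" if y: "y \<in> El X" "u \<in> Reals" for y u
    using t[OF y(1)] y(2) less_linear[of u "t y"] by blast
  have "\<exists>h. continuous h \<and> (\<forall>y\<in>El X. ap h y = t y)"
  proof (rule continuous_exists)
    show "definable (\<lambda>s. ?Q (s 0) (s (Suc 0)))"
      by (intro definable_intros capped_bound_definable)
    fix a assume a: "a \<in> Reals"
    \<comment> \<open>If no \<open>min (g y) (e n)\<close> exceeds \<open>a \<ge> 0\<close>, then \<open>a\<close> is a bound, so \<open>t y \<le> a\<close>.\<close>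
    have up: "a \<prec> t y \<longleftrightarrow> a \<prec> r0 \<or> (\<exists>n\<in>El omega. \<exists>g\<in>El (ap G n). a \<prec> ap g y \<and> a \<prec> ap e n)"
      if y: "y \<in> El X" for y
    proof -
      have tR: "t y \<in> Reals" and tQ: "?Q y (t y)" using t[OF y] by blast+
      have "a \<prec> r0 \<or> \<not> capped_bound G e y a" if "a \<prec> t y" using tQ that a by blast
      moreover have "a \<prec> t y" if "a \<prec> r0" using less_le_trans[OF that] tQ tR a by simp
      moreover have "a \<prec> t y" if unbounded: "\<not> capped_bound G e y a"
      proof (rule ccontr)
        assume n: "\<not> a \<prec> t y"
        obtain n g where *: "n \<in> El omega" "g \<in> El (ap G n)" "a \<prec> ap g y" "a \<prec> ap e n"
          using unbounded unfolding capped_bound_def by blast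
        then have "t y \<prec> ap g y" "t y \<prec> ap e n"
          using le_less_trans[OF n] tR a eR gR y by blast+
        then show False using tQ * unfolding capped_bound_def by blast
      qed
      ultimately show ?thesis unfolding capped_bound_def by blast
    qed
    have "open_pred (\<lambda>y. a \<prec> r0 \<or> (\<exists>n\<in>El omega. \<exists>g\<in>El (ap G n). a \<prec> ap g y \<and> a \<prec> ap e n))"
    proof (rule open_pred_disj[OF _ _ open_pred_const])
      show "open_pred (\<lambda>y. \<exists>n\<in>El omega. \<exists>g\<in>El (ap G n). a \<prec> ap g y \<and> a \<prec> ap e n)"
      proof (rule open_pred_local)
        fix y assume "\<exists>n\<in>El omega. \<exists>g\<in>El (ap G n). a \<prec> ap g y \<and> a \<prec> ap e n"
        then obtain n g where n: "n \<in> El omega" "g \<in> El (ap G n)" "a \<prec> ap g y" "a \<prec> ap e n" by blast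
        show "\<exists>Q. open_pred Q \<and> Q y \<and> (\<forall>z\<in>El X. Q z \<longrightarrow>
            (\<exists>n\<in>El omega. \<exists>g\<in>El (ap G n). a \<prec> ap g z \<and> a \<prec> ap e n))"
          by (rule exI[of _ "\<lambda>z. a \<prec> ap g z"], intro conjI continuous_open_pred cont[OF n(1,2)] a)
            (use n in blast)+
      qed (intro definable_intros)
    qed (intro definable_intros)+
    then show "open_pred (\<lambda>y. a \<prec> t y)" by (rule open_pred_cong) (use up in blast)
    \<comment> \<open>The condition \<open>?C b y\<close> implies that \<open>b\<close> is a bound, and it holds for each \<open>b\<close> above \<open>t y\<close>.\<close>
    let ?C = "\<lambda>b y. \<forall>n\<in>El omega. \<forall>g\<in>El (ap G n). \<not> ap e n \<prec> b \<longrightarrow> ap g y \<prec> b"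
    have down: "t y \<prec> a \<longleftrightarrow> (\<exists>b\<in>Reals. r0 \<prec> b \<and> b \<prec> a \<and> ?C b y)" if y: "y \<in> El X" for y
    proof
      have tR: "t y \<in> Reals" and tQ: "?Q y (t y)" using t[OF y] by blast+
      {
        assume "t y \<prec> a"
        then obtain b where b: "b \<in> Reals" "t y \<prec> b" "b \<prec> a" using dense tR a by blast
        have "r0 \<prec> b" using le_less_trans[OF _ b(2)] tQ tR b by simp
        moreover have "?C b y"
        proof (intro ballI impI, rule ccontr)
          fix n g assume n: "n \<in> El omega" "g \<in> El (ap G n)" "\<not> ap e n \<prec> b" "\<not> ap g y \<prec> b"
          then have "t y \<prec> ap e n" "t y \<prec> ap g y"
            using less_le_trans[OF b(2)] tR b eR gR y by blast+
          then show False using tQ n unfolding capped_bound_def by blast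
        qed
        ultimately show "\<exists>b\<in>Reals. r0 \<prec> b \<and> b \<prec> a \<and> ?C b y" using b by blast
      }
      assume "\<exists>b\<in>Reals. r0 \<prec> b \<and> b \<prec> a \<and> ?C b y"
      then obtain b where b: "b \<in> Reals" "r0 \<prec> b" "b \<prec> a" "?C b y" by blast
      have "capped_bound G e y b"
        unfolding capped_bound_def
      proof (intro ballI notI)
        fix n g assume n: "n \<in> El omega" "g \<in> El (ap G n)" "b \<prec> ap g y \<and> b \<prec> ap e n"
        then have "\<not> ap e n \<prec> b" using less_asym eR b by blast
        then have "ap g y \<prec> b" using b n by blast
        then show False using n less_asym gR y b by blast
      qed
      then have "\<not> b \<prec> t y" using tQ b less_asym[OF b(2)] by simp
      then show "t y \<prec> a" using le_less_trans[OF _ b(3)] tR b a by simp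
    qed
    have "open_pred (\<lambda>y. \<exists>b\<in>Reals. r0 \<prec> b \<and> b \<prec> a \<and> ?C b y)"
    proof (rule open_pred_local)
      fix y assume "\<exists>b\<in>Reals. r0 \<prec> b \<and> b \<prec> a \<and> ?C b y"
      then obtain b where b: "b \<in> Reals" "r0 \<prec> b" "b \<prec> a" "?C b y" by blast
      obtain N where N: "N \<in> El omega" "\<forall>n\<in>El omega. n \<notin> El N \<longrightarrow> ap e n \<prec> b"
        using e_null b by blast
      have "open_pred (\<lambda>z. \<forall>n\<in>El m. \<forall>g\<in>El (ap G n). \<not> ap e n \<prec> b \<longrightarrow> ap g z \<prec> b)" if "m \<in> El omega" for m
        using that
      proof (induction m rule: omega_induct)
        case definable show ?case by (intro definable_intros)
      next
        case zero
        show ?case using open_pred_const[of True] by simp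
      next
        case (succ m)
        have "open_pred (\<lambda>z. \<forall>g\<in>El (ap G m). \<not> ap e m \<prec> b \<longrightarrow> ap g z \<prec> b)"
        proof (rule open_pred_finite_ball[OF fin[OF succ(1)]])
          show "definable (\<lambda>s. \<not> ap e m \<prec> b \<longrightarrow> ap (s 0) (s (Suc 0)) \<prec> b)"
            by (intro definable_intros)
          fix g assume "g \<in> El (ap G m)"
          then have "open_pred (\<lambda>z. ap g z \<prec> b)" using continuous_open_pred(2) cont succ(1) b(1) by blast
          then show "open_pred (\<lambda>z. \<not> ap e m \<prec> b \<longrightarrow> ap g z \<prec> b)"
            using open_pred_const[of True] by (cases "ap e m \<prec> b") simp_all
        qed
        from open_pred_conj[OF this succ(2)] show ?case by simp
      qed
      from this[OF N(1)] have "open_pred (?C b)"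
        by (rule open_pred_cong) (use N mem_omega[OF N(1)] in blast)
      then show "\<exists>Q. open_pred Q \<and> Q y \<and> (\<forall>z\<in>El X. Q z \<longrightarrow> (\<exists>b\<in>Reals. r0 \<prec> b \<and> b \<prec> a \<and> ?C b z))"
        by - (rule exI[of _ "?C b"], rule conjI, assumption, use b in blast)
    qed (intro definable_intros)
    then show "open_pred (\<lambda>y. t y \<prec> a)" by (rule open_pred_cong) (use down in blast)
  qed (use t uniq in blast)+
  then obtain h where "continuous h" "\<forall>y\<in>El X. ap h y = t y" by blast
  then show ?thesis using t by (intro exI[of _ h]) simp
qed

text \<open>
  The multiple choice axiom is applied to the sets of all admissible functions; the supremum over
  the finite sets it returns is a single function with the required zeros.
\<close>

lemma zero_set_countable_Inter:
  assumes CMC: "CMC mem" and x: "x \<in> El X"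
    and Z: "\<And>n. n \<in> El omega \<Longrightarrow> \<exists>Z. zeroset Z \<and> x \<in> El Z \<and> El Z \<subseteq> El (ap F n)"
  shows "\<exists>Z. zeroset Z \<and> x \<in> El Z \<and> (\<forall>n\<in>El omega. El Z \<subseteq> El (ap F n))"
proof -
  obtain p where p: "El p = {z. \<exists>x\<in>El X. \<exists>y\<in>Reals. z = pair x y}" using product by blast
  define adm where "adm n g \<longleftrightarrow> continuous g \<and> ap g x = r0 \<and>
    (\<forall>y\<in>El X. \<not> ap g y \<prec> r0) \<and> (\<forall>y\<in>El X. ap g y = r0 \<longrightarrow> y \<in> El (ap F n))" for n g
  define t where "t n = (THE b. El b = {g \<in> El (powerset p). adm n g})" for n
  have t: "El (t n) = {g \<in> El (powerset p). adm n g}" for n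
    unfolding t_def adm_def by (rule El_the, rule separation) (intro definable_intros)
  have adm_in: "g \<in> El (t n)" if "adm n g" for n g
    using that unfolding t adm_def continuous_real_def is_function_def is_pair_iff El_powerset p by blast
  have "\<exists>A. is_function mem A omega (powerset (powerset p)) \<and> (\<forall>n\<in>El omega. app mem A n = t n)"
  proof (rule function_exists[where Q = "\<lambda>n b. \<forall>g. g \<in> El b \<longleftrightarrow> g \<in> El (powerset p) \<and> adm n g"])
    show "definable (\<lambda>s. \<forall>g. g \<in> El (s (Suc 0)) \<longleftrightarrow> g \<in> El (powerset p) \<and> adm (s 0) g)"
      unfolding adm_def by (intro definable_intros)
    show "t n \<in> El (powerset (powerset p))" for n
      unfolding El_powerset[of "powerset p"] mem_Collect_eq t by blast
    show "(\<forall>g. g \<in> El b \<longleftrightarrow> g \<in> El (powerset p) \<and> adm n g) \<longleftrightarrow> b = t n" for n b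
      using ext_El[of b "t n"] t[of n] by auto
  qed
  then obtain A where A: "is_function mem A omega (powerset (powerset p))"
    "\<And>n. n \<in> El omega \<Longrightarrow> app mem A n = t n" by blast
  have ne: "El (t n) \<noteq> {}" if n: "n \<in> El omega" for n
  proof -
    obtain Z where Zn: "zeroset Z" "x \<in> El Z" "El Z \<subseteq> El (ap F n)" using Z[OF n] by blast
    obtain h where "continuous h" "\<forall>y\<in>El X. \<not> ap h y \<prec> r0"
      "\<forall>y. y \<in> El Z \<longleftrightarrow> y \<in> El X \<and> ap h y = r0"
      using zero_set_nonneg[OF Zn(1)] by blast
    then have "adm n h" unfolding adm_def using Zn by blast
    then show ?thesis using adm_in by blast
  qed
  have "\<forall>w b A. is_omega mem w \<and> is_function mem A w b \<and> (\<forall>n\<in>El w. El (app mem A n) \<noteq> {}) \<longrightarrow>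
        (\<exists>c F. is_function mem F w c \<and>
           (\<forall>n\<in>El w. El (app mem F n) \<noteq> {} \<and> El (app mem F n) \<subseteq> El (app mem A n) \<and>
              finite_in_model mem (app mem F n)))"
    using CMC unfolding CMC_def .
  from this[rule_format, of omega A "powerset (powerset p)"] A ne
  obtain c G where G: "is_function mem G omega c" and
    "\<forall>n\<in>El omega. El (app mem G n) \<noteq> {} \<and> El (app mem G n) \<subseteq> El (app mem A n) \<and>
      finite_in_model mem (app mem G n)"
    using is_omega_iff[of omega] by auto
  then have Gn: "El (ap G n) \<noteq> {}" "finite_in_model mem (ap G n)" "\<And>g. g \<in> El (ap G n) \<Longrightarrow> adm n g"
    if "n \<in> El omega" for n
    using that A(2)[OF that] app_eq_ap[OF G that] t[of n] by (auto dest!: bspec)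
  obtain e where e: "is_function mem e omega (Dom R)"
     "\<forall>n\<in>El omega. r0 \<prec> ap e n \<and> \<not> r1 \<prec> ap e n"
     "\<forall>a\<in>Reals. r0 \<prec> a \<longrightarrow> (\<exists>N\<in>El omega. \<forall>n\<in>El omega. n \<notin> El N \<longrightarrow> ap e n \<prec> a)"
    using null_sequence_exists by blast
  have "\<exists>h. continuous h \<and> (\<forall>y\<in>El X. \<not> ap h y \<prec> r0 \<and> capped_bound G e y (ap h y) \<and>
     (\<forall>v\<in>Reals. \<not> v \<prec> r0 \<longrightarrow> capped_bound G e y v \<longrightarrow> \<not> v \<prec> ap h y))"
    by (rule capped_supremum_continuous[OF G]) (use e Gn in \<open>auto simp: adm_def\<close>)
  then obtain h where h: "continuous h" "\<forall>y\<in>El X. \<not> ap h y \<prec> r0"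
     "\<forall>y\<in>El X. capped_bound G e y (ap h y)"
     "\<forall>y\<in>El X. \<forall>v\<in>Reals. \<not> v \<prec> r0 \<longrightarrow> capped_bound G e y v \<longrightarrow> \<not> v \<prec> ap h y"
    by blast
  obtain Z where Zh: "zeroset Z" "\<And>y. y \<in> El Z \<longleftrightarrow> y \<in> El X \<and> ap h y = r0"
    using zero_set_exists[OF h(1)] by blast
  have "capped_bound G e x r0"
    unfolding capped_bound_def using Gn(3) less_irrefl[OF zero_closed] by (simp add: adm_def)
  then have "\<not> r0 \<prec> ap h x" using h(4) x less_irrefl[OF zero_closed] by simp
  then have "ap h x = r0"
    using h(2) x less_linear[of "ap h x" r0] continuous_closed[OF h(1) x] by auto
  then have "x \<in> El Z" using Zh x by blast
  moreover have "y \<in> El (ap F n)" if n: "n \<in> El omega" and y: "y \<in> El Z" for n y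
  proof -
    obtain g where g: "g \<in> El (ap G n)" using Gn(1)[OF n] by blast
    have adm: "adm n g" using Gn(3)[OF n g] .
    have yX: "y \<in> El X" "ap h y = r0" using y Zh by auto
    have "\<not> r0 \<prec> ap g y" using h(3) yX g e(2) n unfolding capped_bound_def by auto
    moreover have "\<not> ap g y \<prec> r0" "ap g y \<in> Reals"
      using adm yX continuous_closed unfolding adm_def by blast+
    ultimately have "ap g y = r0" using less_linear[of "ap g y" r0] by auto
    then show ?thesis using adm yX unfolding adm_def by blast
  qed
  ultimately show ?thesis using Zh(1) by blast
qed

text \<open>
  For \<open>h \<ge> 0\<close> the zero-set of \<open>h\<close> is the intersection of the open sets \<open>{h < e n}\<close>.
\<close>

lemma zero_set_G_delta:
  assumes "zeroset Z" shows "G_delta_set mem \<tau> Z"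
proof -
  obtain h where h: "continuous h" "\<forall>x\<in>El X. \<not> ap h x \<prec> r0"
    "\<forall>x. x \<in> El Z \<longleftrightarrow> x \<in> El X \<and> ap h x = r0"
    using zero_set_nonneg[OF assms] by blast
  obtain e where e: "is_function mem e omega (Dom R)"
     "\<forall>n\<in>El omega. r0 \<prec> ap e n \<and> \<not> r1 \<prec> ap e n"
     "\<forall>a\<in>Reals. r0 \<prec> a \<longrightarrow> (\<exists>N\<in>El omega. \<forall>n\<in>El omega. n \<notin> El N \<longrightarrow> ap e n \<prec> a)"
    using null_sequence_exists by blast
  have hR: "ap h y \<in> Reals" if "y \<in> El X" for y using continuous_closed[OF h(1) that] .
  have "\<forall>n\<in>El omega. \<exists>U\<in>El \<tau>. \<forall>y. y \<in> El U \<longleftrightarrow> y \<in> El X \<and> ap h y \<prec> ap e n"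
    using continuous_open_pred(2)[OF h(1)] ap_closed[OF e(1)] by blast
  from this[unfolded Bex_def, THEN bchoice]
  obtain t where t: "\<forall>n\<in>El omega. t n \<in> El \<tau> \<and> (\<forall>y. y \<in> El (t n) \<longleftrightarrow> y \<in> El X \<and> ap h y \<prec> ap e n)"
    by blast
  have "\<exists>F. is_function mem F omega \<tau> \<and> (\<forall>n\<in>El omega. app mem F n = t n)"
  proof (rule function_exists[where Q = "\<lambda>n U. \<forall>y. y \<in> El U \<longleftrightarrow> y \<in> El X \<and> ap h y \<prec> ap e n"])
    show "definable (\<lambda>s. \<forall>y. y \<in> El (s (Suc 0)) \<longleftrightarrow> y \<in> El X \<and> ap h y \<prec> ap e (s 0))"
      by (intro definable_intros)
    show "(\<forall>y. y \<in> El U \<longleftrightarrow> y \<in> El X \<and> ap h y \<prec> ap e n) \<longleftrightarrow> U = t n" if "n \<in> El omega" for n U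
      using t that ext_El[of U "t n"] by (auto simp: set_eq_iff)
  qed (use t in blast)
  then obtain F where F: "is_function mem F omega \<tau>" "\<And>n. n \<in> El omega \<Longrightarrow> app mem F n = t n" by blast
  have "El Z = (\<Inter>n\<in>El omega. El (app mem F n))"
  proof (rule subset_antisym; rule subsetI)
    fix y assume "y \<in> El Z"
    then show "y \<in> (\<Inter>n\<in>El omega. El (app mem F n))" using h(3) e(2) F(2) t by simp
  next
    fix y assume "y \<in> (\<Inter>n\<in>El omega. El (app mem F n))"
    then have "\<forall>n\<in>El omega. y \<in> El X \<and> ap h y \<prec> ap e n" using F(2) t by simp
    then have y: "y \<in> El X" "\<forall>n\<in>El omega. ap h y \<prec> ap e n" using zero_omega by blast+
    have "\<not> r0 \<prec> ap h y"
    proof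
      assume "r0 \<prec> ap h y"
      then obtain N where N: "N \<in> El omega" "ap e N \<prec> ap h y" using e(3) hR[OF y(1)] not_self by blast
      then show False using y(2) less_asym[OF N(2)] hR[OF y(1)] ap_closed[OF e(1) N(1)] by blast
    qed
    then have "ap h y = r0" using h(2) y(1) hR[OF y(1)] less_linear[of "ap h y" r0] by auto
    then show "y \<in> El Z" using h(3) y(1) by blast
  qed
  then show ?thesis unfolding G_delta_set_def using F(1) is_omega_iff by blast
qed

section \<open>The topology generated by the zero-sets\<close>

definition baire :: "'m \<Rightarrow> bool" where
  "baire U \<longleftrightarrow> El U \<subseteq> El X \<and> (\<forall>x\<in>El U. \<exists>Z. zeroset Z \<and> x \<in> El Z \<and> El Z \<subseteq> El U)"

lemma zero_set_subset: "zeroset Z \<Longrightarrow> El Z \<subseteq> El X"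
  unfolding zero_set_iff by blast

lemma baire_zero_set: "zeroset Z \<Longrightarrow> baire Z"
  unfolding baire_def using zero_set_subset by blast

lemma baire_exists: "\<exists>\<tau>z. El \<tau>z = {U. baire U}"
proof -
  have "\<exists>\<tau>z. El \<tau>z = {U \<in> El (powerset X). \<forall>x\<in>El U. \<exists>Z. zeroset Z \<and> x \<in> El Z \<and> El Z \<subseteq> El U}"
    by (rule separation) (intro definable_intros)
  then show ?thesis unfolding baire_def by simp
qed

lemma baire_topology:
  assumes "El \<tau>z = {U. baire U}"
  shows "topological_space_on mem X \<tau>z"
  unfolding topological_space_on_def assms
proof (intro conjI ballI allI impI)
  show "X \<in> {U. baire U}" using baire_zero_set[OF zero_set_space] by simp
next
  fix U V assume UV: "U \<in> {U. baire U}" "V \<in> {U. baire U}"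
  have "\<exists>W. El W = {x \<in> El U. x \<in> El V}" by (rule separation) (intro definable_intros)
  then obtain W where W: "El W = El U \<inter> El V" by blast
  have "\<exists>Z. zeroset Z \<and> x \<in> El Z \<and> El Z \<subseteq> El W" if x: "x \<in> El W" for x
  proof -
    obtain Y where Y: "zeroset Y" "x \<in> El Y" "El Y \<subseteq> El U" using UV x W unfolding baire_def by blast
    obtain Z where Z: "zeroset Z" "x \<in> El Z" "El Z \<subseteq> El V" using UV x W unfolding baire_def by blast
    obtain Q where "zeroset Q" "El Q = El Y \<inter> El Z" using zero_set_Int[OF Y(1) Z(1)] by blast
    then show ?thesis using Y Z W by blast
  qed
  then have "baire W" unfolding baire_def using UV W unfolding baire_def by blast
  then show "\<exists>W\<in>{U. baire U}. El W = El U \<inter> El V" using W by blast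
next
  fix S assume S: "El S \<subseteq> {U. baire U}"
  obtain W where W: "El W = (\<Union>U\<in>El S. El U)"
    using ZF unfolding ZF_model_def union_axiom_def by blast
  have "baire W" unfolding baire_def W
  proof (intro conjI ballI)
    show "(\<Union>U\<in>El S. El U) \<subseteq> El X" using S unfolding baire_def by blast
    fix x assume "x \<in> (\<Union>U\<in>El S. El U)"
    then obtain U where U: "U \<in> El S" "x \<in> El U" by blast
    then obtain Z where "zeroset Z" "x \<in> El Z" "El Z \<subseteq> El U" using S unfolding baire_def by blast
    then show "\<exists>Z. zeroset Z \<and> x \<in> El Z \<and> El Z \<subseteq> (\<Union>U\<in>El S. El U)" using U by blast
  qed
  then show "\<exists>W\<in>{U. baire U}. El W = (\<Union>U\<in>El S. El U)" using W by blast
qed (simp add: baire_def)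

text \<open>
  Each member is the union of all zero-sets inside it, so any family of members that contains the zero-sets
  is a base.
\<close>

lemma baire_is_base:
  assumes \<tau>z: "El \<tau>z = {U. baire U}"
    and B: "B \<subseteq> El \<tau>z" "{Z. zeroset Z} \<subseteq> B"
  shows "is_base mem \<tau>z B"
  unfolding is_base_def
proof (intro conjI ballI)
  fix U assume U: "U \<in> El \<tau>z"
  have "\<exists>S. El S = {Z \<in> El (powerset X). zeroset Z \<and> El Z \<subseteq> El U}"
    by (rule separation) (intro definable_intros)
  then obtain S where S: "El S = {Z \<in> El (powerset X). zeroset Z \<and> El Z \<subseteq> El U}" by blast
  then have S': "El S = {Z. zeroset Z \<and> El Z \<subseteq> El U}" using zero_set_subset by auto
  have "El U = (\<Union>V\<in>El S. El V)" using U unfolding \<tau>z baire_def S' by blast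
  moreover have "El S \<subseteq> B" using S' B(2) by blast
  ultimately show "\<exists>S. El S \<subseteq> B \<and> El U = (\<Union>V\<in>El S. El V)" by blast
qed (rule B(1))

text \<open>
  Stated for an arbitrary family \<open>\<sigma>\<close>, because it serves both for the given topology and for the
  Baire topology itself.
\<close>

lemma baire_G_delta:
  assumes "CMC mem" and G: "G_delta_set mem \<sigma> G"
    and \<sigma>: "\<And>U. U \<in> El \<sigma> \<Longrightarrow> baire U"
  shows "baire G"
proof -
  obtain F where F: "is_function mem F omega \<sigma>" "El G = (\<Inter>n\<in>El omega. El (app mem F n))"
    using G unfolding G_delta_set_def is_omega_iff by blast
  then have G: "El G = (\<Inter>n\<in>El omega. El (ap F n))" using app_eq_ap[OF F(1)] by auto
  have b: "baire (ap F n)" if "n \<in> El omega" for n using \<sigma> ap_closed[OF F(1) that] by blast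
  show ?thesis unfolding baire_def
  proof (intro conjI ballI)
    show sub: "El G \<subseteq> El X" using b[OF zero_omega] zero_omega unfolding G baire_def by blast
    fix x assume x: "x \<in> El G"
    have "\<exists>Z. zeroset Z \<and> x \<in> El Z \<and> (\<forall>n\<in>El omega. El Z \<subseteq> El (ap F n))"
    proof (rule zero_set_countable_Inter[OF assms(1)])
      show "x \<in> El X" using sub x by blast
      show "\<exists>Z. zeroset Z \<and> x \<in> El Z \<and> El Z \<subseteq> El (ap F n)" if "n \<in> El omega" for n
        using b[OF that] x that unfolding G baire_def by blast
    qed
    then show "\<exists>Z. zeroset Z \<and> x \<in> El Z \<and> El Z \<subseteq> El G" unfolding G by blast
  qed
qed

lemma G_delta_open:
  assumes "U \<in> El \<sigma>" shows "G_delta_set mem \<sigma> U"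
proof -
  have "\<exists>F. is_function mem F omega \<sigma> \<and> (\<forall>n\<in>El omega. app mem F n = U)"
    by (rule function_exists[where Q = "\<lambda>n V. V = U"]) (intro definable_intros, use assms in auto)
  then obtain F where F: "is_function mem F omega \<sigma>" "\<forall>n\<in>El omega. app mem F n = U" by blast
  moreover have "El omega \<noteq> {}" using zero_omega by blast
  ultimately have "El U = (\<Inter>n\<in>El omega. El (app mem F n))" by simp
  then show ?thesis unfolding G_delta_set_def is_omega_iff using F(1) by blast
qed

end

theorem corollary2p31:
  fixes mem :: "'m \<Rightarrow> 'm \<Rightarrow> bool"
    and R :: "'m ordered_field_structure"
    and X \<tau> :: 'm
  assumes "ZF_model mem"
    and "CMC mem"
    and "real_line mem R"
    and "completely_regular mem R X \<tau>"
  shows "\<exists>\<tau>z \<tau>d. is_Baire_topology mem R X \<tau> \<tau>z \<and> is_G_delta_topology mem X \<tau> \<tau>d \<and>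
           \<tau>z = \<tau>d \<and> P_space mem X \<tau>z"
proof -
  have space: "topological_space_on mem X \<tau>"
    using assms(4) unfolding completely_regular_def by (rule conjunct1)
  interpret ZF_space mem R X \<tau>
    by unfold_locales (rule assms space)+
  obtain \<tau>z where \<tau>z: "El \<tau>z = {U. baire U}" using baire_exists by blast
  have open_baire: "baire U" if "U \<in> El \<tau>" for U
    unfolding baire_def using open_subset[OF that] zero_set_in_open[OF assms(4) that] by blast
  have G_delta: "{G. G_delta_set mem \<tau> G} \<subseteq> El \<tau>z"
    unfolding \<tau>z using baire_G_delta[OF assms(2)] open_baire by blast
  have "is_base mem \<tau>z {Z. zeroset Z}"
    by (rule baire_is_base[OF \<tau>z]) (use \<tau>z baire_zero_set in auto)
  moreover have "is_base mem \<tau>z {G. G_delta_set mem \<tau> G}"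
    by (rule baire_is_base[OF \<tau>z G_delta]) (use zero_set_G_delta in blast)
  moreover have "{G. G_delta_set mem \<tau>z G} = El \<tau>z"
    using baire_G_delta[OF assms(2), of \<tau>z] G_delta_open \<tau>z by blast
  ultimately show ?thesis
    unfolding is_Baire_topology_def is_G_delta_topology_def P_space_def
    using baire_topology[OF \<tau>z] by blast
qed

end
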